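(* Let $n\ge1$ be an integer. There are constants $c_1,c_2>0$ depending only on $n$ such that for every weight $w$ on $\mathbb{S}\subset\mathbb{C}^n$, $$Q_2(w)\le c_1\,\widetilde Q_2(w)\qquad\text{and}\qquad \widetilde Q_2(w)\le c_2\,Q_2(w)^2 .$$ In particular, $A_2$ and $\widetilde A_2$ are the same class of weights on $\mathbb{S}$.
   Context: Let $\mathbb{B}=\{z\in\mathbb{C}^n:|z|<1\}$, $\mathbb{S}=\{z\in\mathbb{C}^n:|z|=1\}$, $\langle z,w\rangle=\sum_kz_k\bar w_k$, and let $\sigma$ be normalized surface measure on $\mathbb{S}$. A weight is a positive function $w\in L^1(\mathbb{S})$. Quantities below are allowed to take the value $+\infty$. Non-isotropic balls on $\mathbb{S}$ are the sets $\{\eta\in\mathbb{S}:|1-\langle\xi,\eta\rangle|^{1/2}<\delta\}$ with $\xi\in\mathbb{S}$, $\delta>0$. The classical $A_2$ characteristic is $$Q_2(w)=\sup_B\Big(\frac1{\sigma(B)}\int_Bw\,d\sigma\Big)\Big(\frac1{\sigma(B)}\int_Bw^{-1}\,d\sigma\Big),$$ the supremum being over all non-isotropic balls $B$ on $\mathbb{S}$; $A_2$ is the class of weights with $Q_2(w)<\infty$. For a nonnegative measurable function $h$ on $\mathbb{S}$, its Poisson–Szegő integral is $\widetilde h(z)=\int_{\mathbb{S}}\frac{(1-|z|^2)^n}{|1-\langle z,\zeta\rangle|^{2n}}h(\zeta)\,d\sigma(\zeta)$, $z\in\mathbb{B}$. The invariant $A_2$ characteristic is $\widetilde Q_2(w)=\sup_{z\in\mathbb{B}}\widetilde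 w(z)\,\widetilde{w^{-1}}(z)$; $\widetilde A_2$ is the class of weights with $\widetilde Q_2(w)<\infty$. *)

theory Defs
  imports "HOL-Analysis.Analysis" "HOL-Probability.Probability_Measure"
begin

text \<open>Complex n-space is \<^typ>\<open>complex^'n\<close> with n = \<^term>\<open>CARD('n)\<close>; its library norm is the
  usual one, so the unit ball and sphere are \<^term>\<open>ball 0 1\<close> and \<^term>\<open>sphere 0 1\<close>.
  The library inner product on this type is the real part of the Hermitian product below.\<close>

definition cdot :: "complex^'n \<Rightarrow> complex^'n \<Rightarrow> complex" where
  "cdot z w = (\<Sum>k\<in>UNIV. z $ k * cnj (w $ k))"

text \<open>Normalized surface measure, by polar coordinates: the measure of a Borel set \<open>A\<close> of the sphere
  is the proportion of the volume of the unit ball taken by the cone of points \<open>z\<close> whose radial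
  projection \<open>sgn z = z / |z|\<close> lies in \<open>A\<close>. The origin (\<open>sgn 0 = 0\<close>) is a null set and is removed
  by restricting to the sphere. The completion makes all Lebesgue measurable functions on the
  sphere measurable.\<close>

definition sphere_sigma :: "(complex^'n) measure" where
  "sphere_sigma =
     completion (restrict_space (distr (uniform_measure lborel (ball 0 1)) borel sgn) (sphere 0 1))"

text \<open>Elements of \<open>L\<^sup>1\<close> are determined only up to null sets, so positivity is required almost
  everywhere. Values of a weight outside the sphere play no role.\<close>

definition weight :: "(complex^'n \<Rightarrow> real) \<Rightarrow> bool" where
  "weight w \<longleftrightarrow> integrable sphere_sigma w \<and> (AE x in sphere_sigma. w x > 0)"

definition nonisotropic_ball :: "complex^'n \<Rightarrow> real \<Rightarrow> (complex^'n) set" where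
  "nonisotropic_ball \<xi> \<delta> = {\<eta> \<in> sphere 0 1. sqrt (cmod (1 - cdot \<xi> \<eta>)) < \<delta>}"

definition sphere_avg :: "(complex^'n) set \<Rightarrow> (complex^'n \<Rightarrow> real) \<Rightarrow> ennreal" where
  "sphere_avg B h = (\<integral>\<^sup>+x\<in>B. ennreal (h x) \<partial>sphere_sigma) / emeasure sphere_sigma B"

definition Q2 :: "(complex^'n \<Rightarrow> real) \<Rightarrow> ennreal" where
  "Q2 w = (SUP (\<xi>, \<delta>) \<in> sphere 0 1 \<times> {0<..}.
     sphere_avg (nonisotropic_ball \<xi> \<delta>) w *
     sphere_avg (nonisotropic_ball \<xi> \<delta>) (\<lambda>x. inverse (w x)))"

definition A2 :: "(complex^'n \<Rightarrow> real) set" where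
  "A2 = {w. weight w \<and> Q2 w < \<infinity>}"

definition poisson_szego :: "(complex^'n \<Rightarrow> real) \<Rightarrow> complex^'n \<Rightarrow> ennreal" where
  "poisson_szego h z =
     (\<integral>\<^sup>+\<zeta>. ennreal ((1 - (norm z)^2) ^ CARD('n) / cmod (1 - cdot z \<zeta>) ^ (2 * CARD('n)))
           * ennreal (h \<zeta>) \<partial>sphere_sigma)"

definition Q2_inv :: "(complex^'n \<Rightarrow> real) \<Rightarrow> ennreal" where
  "Q2_inv w = (SUP z \<in> ball 0 1. poisson_szego w z * poisson_szego (\<lambda>x. inverse (w x)) z)"

definition A2_inv :: "(complex^'n \<Rightarrow> real) set" where
  "A2_inv = {w. weight w \<and> Q2_inv w < \<infinity>}"

lemma norm_power2_eq_cdot: "complex_of_real ((norm z)^2) = cdot z z" for z :: "complex^'n"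
proof -
  have "(norm z)^2 = (\<Sum>k\<in>UNIV. (cmod (z $ k))^2)"
    by (simp add: norm_vec_def L2_set_def sum_nonneg)
  thus ?thesis
    by (simp add: cdot_def complex_norm_square del: of_real_power)
qed

lemma prob_space_sphere_sigma: "prob_space (sphere_sigma :: (complex^'n) measure)"
proof -
  let ?U = "uniform_measure lborel (ball 0 1) :: (complex^'n) measure"
  let ?D = "distr ?U borel sgn"
  let ?R = "restrict_space ?D (sphere 0 1)"
  have fin: "emeasure lborel (ball 0 1 :: (complex^'n) set) \<noteq> \<infinity>"
    using emeasure_lborel_ball_finite[of "0 :: complex^'n" 1] by simp
  have pos: "emeasure lborel (ball 0 1 :: (complex^'n) set) \<noteq> 0"
  proof
    assume "emeasure lborel (ball 0 1 :: (complex^'n) set) = 0"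
    hence "ball 0 1 \<in> null_sets (lborel :: (complex^'n) measure)" by auto
    hence "negligible (ball 0 1 :: (complex^'n) set)"
      by (simp add: negligible_iff_null_sets null_sets_completionI)
    thus False using open_not_negligible[of "ball 0 1 :: (complex^'n) set"] by simp
  qed
  interpret U: prob_space ?U by (rule prob_space_uniform_measure) (use fin pos in auto)
  have sgnm: "sgn \<in> measurable ?U borel"
    unfolding sgn_div_norm by measurable
  have "emeasure ?D (sphere 0 1) = emeasure ?U (sgn -` sphere 0 1 \<inter> space ?U)"
    by (rule emeasure_distr[OF sgnm]) auto
  also have "sgn -` sphere 0 1 \<inter> space ?U = UNIV - {0 :: complex^'n}"
    by (auto simp: norm_sgn)
  also have "emeasure ?U (UNIV - {0}) = 1"
  proof -
    have z: "emeasure lborel (ball 0 1 \<inter> {0 :: complex^'n}) = 0" by simp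
    have "{0} \<in> null_sets ?U"
      by (auto simp: null_sets_def emeasure_uniform_measure z)
    hence "emeasure ?U (space ?U - {0}) = emeasure ?U (space ?U)"
      by (rule emeasure_Diff_null_set) auto
    thus ?thesis using U.emeasure_space_1 by simp
  qed
  finally have "emeasure ?R (space ?R) = 1"
    by (subst emeasure_restrict_space) (auto simp: space_restrict_space)
  hence "prob_space ?R" by (rule prob_spaceI)
  thus ?thesis unfolding sphere_sigma_def
    by (rule prob_space.prob_space_completion)
qed

end

theory Submission
  imports Defs
begin

text \<open>
  Write \<open>d(\<xi>,\<eta>) = |1 - \<langle>\<xi>,\<eta>\<rangle>|\<^sup>1\<^sup>/\<^sup>2\<close> and let \<open>B(\<xi>,\<delta>)\<close> be the non-isotropic balls. The only geometric
  input is that \<open>\<sigma>(B(\<xi>,\<delta>))\<close> is comparable to \<open>\<delta>\<^sup>2\<^sup>n\<close>, uniformly in \<open>\<xi>\<close>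
  (\<open>measure_nonisotropic_ball_bounds\<close>). By definition \<open>\<sigma>\<close> measures the cone over the ball. A complex
  reflection, which preserves both the Hermitian product and volume, moves \<open>\<xi>\<close> to a coordinate
  vector; there the cone is squeezed between two coordinate boxes that have size \<open>1\<close> in one real
  direction, about \<open>\<delta>\<^sup>2\<close> in another and about \<open>\<delta>\<close> in the other \<open>2n-2\<close>.

  For \<open>Q\<^sub>2 \<le> c\<^sub>1 Q\<^sub>2~\<close> one compares an average over \<open>B(\<xi>,\<delta>)\<close> with the Poisson-Szego integral at
  \<open>z = (1 - \<delta>\<^sup>2)\<xi>\<close>, or at \<open>0\<close> if \<open>\<delta> \<ge> 1\<close>. For \<open>\<delta> < 1\<close>, on \<open>B(\<xi>,\<delta>)\<close> the kernel is at least a constant times \<open>\<delta>\<^sup>-\<^sup>2\<^sup>n\<close>.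

  For \<open>Q\<^sub>2~ \<le> c\<^sub>2 Q\<^sub>2\<^sup>2\<close> let \<open>z = r\<xi>\<close>, let \<open>B\<^sub>0 \<supseteq> B\<^sub>1 \<supseteq> \<dots> \<supseteq> B\<^sub>J\<close> be balls centred at \<open>\<xi>\<close> with
  geometrically decreasing radii \<open>R\<^sub>i\<close>, from \<open>B\<^sub>0\<close> equal to the sphere down to \<open>R\<^sub>J\<^sup>2\<close> comparable to
  \<open>1 - r\<close>, and put \<open>\<rho>\<^sub>i = R\<^sub>i\<^sup>2\<^sup>n\<close>. The kernel is dominated by \<open>L \<Sum>\<^sub>i \<rho>\<^sub>J \<rho>\<^sub>i\<^sup>-\<^sup>2 1\<^sub>B\<^sub>i\<close>, so with
  \<open>W\<^sub>i = \<integral> w\<close> and \<open>V\<^sub>i = \<integral> 1/w\<close> over \<open>B\<^sub>i\<close> one has to bound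
  \<open>\<rho>\<^sub>J\<^sup>2 \<Sum>\<^sub>i\<^sub>,\<^sub>k \<rho>\<^sub>i\<^sup>-\<^sup>2 \<rho>\<^sub>k\<^sup>-\<^sup>2 W\<^sub>i V\<^sub>k\<close>. For \<open>i \<le> k\<close> the \<open>A\<^sub>2\<close> condition \<open>W\<^sub>i V\<^sub>i \<le> C Q \<rho>\<^sub>i\<^sup>2\<close> on the larger ball
  turns a term into at most \<open>C Q (\<rho>\<^sub>J/\<rho>\<^sub>k)\<^sup>2 V\<^sub>k/V\<^sub>i\<close>. The trivial bound \<open>V\<^sub>k \<le> V\<^sub>i\<close> would lose the number
  of scales, but the weight has reverse doubling: by Cauchy-Schwarz the annulus \<open>B\<^sub>i - B\<^sub>i\<^sub>+\<^sub>1\<close> carries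
  at least the fraction \<open>1/(4Q)\<close> of \<open>V\<^sub>i\<close>, hence \<open>V\<^sub>i\<^sub>+\<^sub>1 \<le> (1 - 1/(4Q)) V\<^sub>i\<close>
  (\<open>reverse_doubling\<close>). The sum over \<open>i\<close> therefore costs a factor \<open>4Q\<close>, the sum over \<open>k\<close> is
  geometric, and the total is a constant times \<open>Q\<^sup>2\<close>
  (\<open>product_of_weighted_sums_le\<close>). The second power of \<open>Q\<close> is the price of reverse doubling.
  Pairs with \<open>k \<le> i\<close> are handled by exchanging \<open>w\<close> and \<open>1/w\<close>.
\<close>

section \<open>Isometries preserve volume\<close>

lemma open_orthogonal_image:
  fixes T :: "'a::euclidean_space \<Rightarrow> 'a"
  assumes "orthogonal_transformation T" "open S"
  shows "open (T ` S)"
  using assms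
  by (intro open_surjective_linear_image orthogonal_transformation_linear orthogonal_transformation_surj)

text \<open>
  By Vitali's theorem an open set is, up to a null set, a disjoint union of countably many balls, and
  an isometry maps these to disjoint balls of the same radii. This gives one inequality without any
  knowledge of the image of the null set; the inverse isometry gives the other.
\<close>

lemma emeasure_orthogonal_image_ge:
  fixes T :: "'a::euclidean_space \<Rightarrow> 'a"
  assumes T: "orthogonal_transformation T" and S: "open S"
  shows "emeasure lborel S \<le> emeasure lborel (T ` S)"
proof -
  define K where "K = {(c, r). r > 0 \<and> ball c r \<subseteq> S}"
  have fine: "\<exists>i. i \<in> K \<and> x \<in> ball (fst i) (snd i) \<and> snd i < d" if xd: "x \<in> S" "0 < d" for x d
  proof -
    obtain e where e: "e > 0" "ball x e \<subseteq> S" using S xd openE by blast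
    have "(x, min e (d/2)) \<in> K"
      using e xd by (auto simp: K_def)
    thus ?thesis using e xd by (intro exI[of _ "(x, min e (d/2))"]) auto
  qed
  obtain C where C: "countable C" "C \<subseteq> K"
    "pairwise (\<lambda>i j. disjnt (ball (fst i) (snd i)) (ball (fst j) (snd j))) C"
    "negligible (S - (\<Union>i\<in>C. ball (fst i) (snd i)))"
    using Vitali_covering_theorem_balls[of S K fst snd, OF fine] by blast
  let ?b = "\<lambda>i::'a \<times> real. ball (fst i) (snd i)"
  have dj: "disjoint_family_on ?b C"
    using C(3) by (auto simp: disjoint_family_on_def pairwise_def disjnt_def)
  have Tb: "T ` ?b i = ball (T (fst i)) (snd i)" for i
    by (rule image_orthogonal_transformation_ball[OF T])
  have djT: "disjoint_family_on (\<lambda>i. T ` ?b i) C"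
    using dj orthogonal_transformation_inj[OF T]
    by (fastforce simp: disjoint_family_on_def inj_def)
  have same: "emeasure lborel (T ` ?b i) = emeasure lborel (?b i)" if "i \<in> C" for i
    using that C(2) by (auto simp: K_def Tb emeasure_ball less_imp_le)
  have m: "(\<Union>i\<in>C. ?b i) \<in> sets lborel" by (auto intro!: sets.countable_UN' C(1))
  have "S - (\<Union>i\<in>C. ?b i) \<in> null_sets lborel"
    using C(4) S m by (auto simp: null_sets_completion_iff negligible_iff_null_sets)
  hence "emeasure lborel S \<le> emeasure lborel (\<Union>i\<in>C. ?b i)"
    using S m
    by (intro emeasure_mono_AE AE_I[where N="S - (\<Union>i\<in>C. ?b i)"])
       (auto simp: null_sets_def)
  also have "\<dots> = (\<integral>\<^sup>+i. emeasure lborel (?b i) \<partial>count_space C)"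
    by (rule emeasure_UN_countable[OF _ C(1) dj]) auto
  also have "\<dots> = (\<integral>\<^sup>+i. emeasure lborel (T ` ?b i) \<partial>count_space C)"
    by (rule nn_integral_cong) (simp add: same)
  also have "\<dots> = emeasure lborel (\<Union>i\<in>C. T ` ?b i)"
    by (rule emeasure_UN_countable[OF _ C(1) djT, symmetric]) (auto simp: Tb)
  also have "\<dots> \<le> emeasure lborel (T ` S)"
  proof (rule emeasure_mono)
    have "?b i \<subseteq> S" if "i \<in> C" for i 
    proof -
      have "i \<in> K" using C(2) that by blast
      thus ?thesis by (simp add: K_def split_beta)
    qed
    thus "(\<Union>i\<in>C. T ` ?b i) \<subseteq> T ` S" by blast
    show "T ` S \<in> sets lborel" using open_orthogonal_image[OF assms] by simp
  qed
  finally show ?thesis .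
qed

lemma emeasure_orthogonal_image:
  fixes T :: "'a::euclidean_space \<Rightarrow> 'a"
  assumes T: "orthogonal_transformation T" and S: "open S"
  shows "emeasure lborel (T ` S) = emeasure lborel S"
proof (rule antisym)
  have "emeasure lborel (T ` S) \<le> emeasure lborel (inv T ` T ` S)"
    using orthogonal_transformation_inv[OF T] open_orthogonal_image[OF assms]
    by (rule emeasure_orthogonal_image_ge)
  also have "inv T ` T ` S = S"
    using T by (simp add: orthogonal_transformation_inj image_image inv_f_f)
  finally show "emeasure lborel (T ` S) \<le> emeasure lborel S" .
qed (rule emeasure_orthogonal_image_ge[OF assms])

section \<open>The Hermitian product and complex reflections\<close>

lemma cdot_add_left: "cdot (x + y) z = cdot x z + cdot y z"
  by (simp add: cdot_def algebra_simps sum.distrib)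

lemma cdot_diff_left: "cdot (x - y) z = cdot x z - cdot y z"
  by (simp add: cdot_def algebra_simps sum_subtractf)

lemma cdot_diff_right: "cdot z (x - y) = cdot z x - cdot z y"
  by (simp add: cdot_def algebra_simps sum_subtractf)

lemma cdot_mult_left: "cdot (a *s x) z = a * cdot x z"
  by (simp add: cdot_def algebra_simps sum_distrib_left)

lemma cdot_mult_right: "cdot z (a *s x) = cnj a * cdot z x"
  by (simp add: cdot_def algebra_simps sum_distrib_left)

lemma cdot_scaleR_left: "cdot (a *\<^sub>R x) z = a *\<^sub>R cdot x z"
  by (simp add: cdot_def scaleR_sum_right)

lemma cdot_commute: "cdot y x = cnj (cdot x y)"
  by (simp add: cdot_def mult.commute)

lemma inner_eq_Re_cdot: "x \<bullet> y = Re (cdot x y)"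
  by (simp add: cdot_def inner_vec_def inner_complex_def)

lemma cdot_axis_left: "cdot (axis k 1) y = cnj (y $ k)"
proof -
  have "cdot (axis k 1) y = (\<Sum>i\<in>UNIV. if i = k then cnj (y $ k) else 0)"
    unfolding cdot_def axis_def by (rule sum.cong) auto
  thus ?thesis by simp
qed

lemma norm_cdot_le: "cmod (cdot x y) \<le> norm x * norm y"
proof (cases "cdot x y = 0")
  case False
  define a where "a = cnj (sgn (cdot x y))"
  have "a * cdot x y = complex_of_real (cmod (cdot x y)) ^ 2 / cmod (cdot x y)"
    by (simp add: a_def sgn_div_norm scaleR_conv_of_real divide_inverse mult_ac
        flip: complex_norm_square)
  hence "a * cdot x y = cmod (cdot x y)"
    using False by (simp add: power2_eq_square)
  hence "cmod (cdot x y) = Re (cdot (a *s x) y)" by (simp add: cdot_mult_left)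
  also have "\<dots> \<le> norm (a *s x) * norm y"
    unfolding inner_eq_Re_cdot[symmetric] by (rule norm_cauchy_schwarz)
  also have "norm (a *s x) = norm x"
  proof -
    have "cmod a = 1" using False by (simp add: a_def norm_sgn)
    thus ?thesis by (simp add: norm_vec_def norm_mult)
  qed
  finally show ?thesis .
qed simp

text \<open>
  The map \<open>T z = z - c \<langle>z,u\<rangle> u\<close> with \<open>u = \<xi> - e\<close> sends \<open>\<xi>\<close> to the coordinate vector \<open>e\<close> as soon as
  \<open>c \<langle>\<xi>,u\<rangle> = 1\<close>, and it is unitary as soon as \<open>2 Re c = |c|\<^sup>2 |u|\<^sup>2\<close>. For unit vectors the first
  equation implies the second. A Householder reflection, with real \<open>c\<close>, would reach \<open>e\<close> only up to a
  phase.
\<close>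

lemma complex_reflection:
  fixes \<xi> :: "complex^'n" and k :: 'n
  assumes "norm \<xi> = 1"
  obtains T where "orthogonal_transformation T" "T \<xi> = axis k 1"
    "\<And>x y. cdot (T x) (T y) = cdot x y"
proof -
  let ?e = "axis k 1 :: complex^'n"
  define u where "u = \<xi> - ?e"
  define c where "c = 1 / (1 - \<xi> $ k)"
  define T where "T z = z - (c * cdot z u) *s u" for z
  have xx: "cdot \<xi> \<xi> = 1" using norm_power2_eq_cdot[of \<xi>] assms by simp
  have xe: "cdot \<xi> ?e = \<xi> $ k" by (subst cdot_commute) (simp add: cdot_axis_left)
  have ee: "cdot ?e ?e = 1" by (simp only: cdot_axis_left) (simp add: axis_def)
  have xu: "cdot \<xi> u = 1 - \<xi> $ k" by (simp add: u_def cdot_diff_right xx xe)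
  have uu: "cdot u u = 2 - \<xi> $ k - cnj (\<xi> $ k)"
    by (simp add: u_def cdot_diff_right cdot_diff_left xx xe ee cdot_axis_left)
  have key: "cnj c + c = c * cnj c * cdot u u"
  proof (cases "\<xi> $ k = 1")
    case False
    hence "1 - cnj (\<xi> $ k) \<noteq> 0" "1 - \<xi> $ k \<noteq> 0"
      by (metis complex_cnj_cnj complex_cnj_one eq_iff_diff_eq_0)+
    thus ?thesis by (simp add: c_def uu field_simps)
  qed (simp add: c_def)
  have cdotT: "cdot (T x) (T y) = cdot x y" for x y
  proof -
    have "cdot (T x) (T y) = cdot x y - cdot x u * cdot u y * (cnj c + c - c * cnj c * cdot u u)"
      unfolding T_def cdot_diff_left cdot_diff_right cdot_mult_left cdot_mult_right
      by (subst (1 2) cdot_commute[of u y]) (simp add: algebra_simps)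
    thus ?thesis by (simp add: key)
  qed
  have lin: "linear T"
  proof (rule linearI)
    show "T (x + y) = T x + T y" for x y
      unfolding T_def cdot_add_left by (simp add: vec_eq_iff algebra_simps)
    show "T (r *\<^sub>R x) = r *\<^sub>R T x" for r x
      unfolding T_def cdot_scaleR_left by (simp add: vec_eq_iff algebra_simps)
  qed
  \<comment> \<open>If the \<open>k\<close>-th coordinate of \<open>\<xi>\<close> is \<open>1\<close>, then \<open>c = 1/0 = 0\<close> and \<open>T\<close> is the identity, which is
    right because then \<open>\<xi> = e\<close>.\<close>
  have "T \<xi> = axis k 1"
  proof (cases "\<xi> $ k = 1")
    case True
    hence "cdot u u = 0" by (simp add: uu)
    hence "u = 0" using norm_power2_eq_cdot[of u] by simp
    thus ?thesis by (simp add: T_def u_def)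
  next
    case False
    hence "c * cdot \<xi> u = 1" by (simp add: c_def xu)
    thus ?thesis by (simp add: T_def u_def)
  qed
  moreover have "orthogonal_transformation T"
    unfolding orthogonal_transformation_def using lin by (simp add: inner_eq_Re_cdot cdotT)
  ultimately show thesis using that cdotT by blast
qed

section \<open>The measure of non-isotropic balls\<close>

text \<open>
  This is the cone over \<open>B(\<xi>, \<surd>t)\<close>; with \<open>t = \<delta>\<^sup>2\<close> as parameter its size in the different directions
  is \<open>1\<close>, \<open>t\<close> and \<open>\<surd>t\<close>.
\<close>

definition nonisotropic_cone :: "complex^'n \<Rightarrow> real \<Rightarrow> (complex^'n) set" where
  "nonisotropic_cone \<xi> t = {z \<in> ball 0 1 - {0}. cmod (1 - cdot \<xi> (sgn z)) < t}"

lemma continuous_on_cdot_right: 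
  "continuous_on S f \<Longrightarrow> continuous_on S (\<lambda>x. cdot \<xi> (f x))"
  unfolding cdot_def by (intro continuous_intros)

lemma open_nonisotropic_cone: "open (nonisotropic_cone \<xi> t)"
proof -
  have "continuous_on (ball 0 1 - {0}) (\<lambda>z. cmod (1 - cdot \<xi> (sgn z)))"
    by (intro continuous_intros continuous_on_cdot_right) auto
  hence "open ((ball 0 1 - {0}) \<inter> (\<lambda>z. cmod (1 - cdot \<xi> (sgn z))) -` {..<t})"
    by (intro continuous_open_preimage) auto
  also have "(ball 0 1 - {0}) \<inter> (\<lambda>z. cmod (1 - cdot \<xi> (sgn z))) -` {..<t} = nonisotropic_cone \<xi> t"
    by (auto simp: nonisotropic_cone_def)
  finally show ?thesis .
qed

lemma Basis_complex_vec:
  "(Basis :: (complex^'n) set) = (\<lambda>(i, u). axis i u) ` (UNIV \<times> {1, \<i>})"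
  by (auto simp: Basis_vec_def Basis_complex_def)

lemma mem_cbox_complex_vec:
  fixes a b :: "complex^'n"
  shows "z \<in> cbox a b \<longleftrightarrow> (\<forall>i. Re (a$i) \<le> Re (z$i) \<and> Re (z$i) \<le> Re (b$i) \<and>
                                Im (a$i) \<le> Im (z$i) \<and> Im (z$i) \<le> Im (b$i))"
  by (auto simp: mem_box Basis_complex_vec inner_axis)

lemma emeasure_cbox_complex_vec:
  fixes a b :: "complex^'n"
  assumes "\<And>i. Re (a$i) \<le> Re (b$i)" "\<And>i. Im (a$i) \<le> Im (b$i)"
  shows "emeasure lborel (cbox a b) =
    ennreal (\<Prod>i\<in>UNIV. (Re (b$i) - Re (a$i)) * (Im (b$i) - Im (a$i)))"
proof -
  have inj: "inj_on (\<lambda>(i, u). axis i u :: complex^'n) (UNIV \<times> {1, \<i>})"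
    by (auto simp: inj_on_def axis_eq_axis)
  have "(\<Prod>v\<in>Basis. (b - a) \<bullet> v) = (\<Prod>(i, u)\<in>UNIV \<times> {1, \<i>}. (b - a) \<bullet> axis i u)"
    unfolding Basis_complex_vec by (subst prod.reindex[OF inj]) (simp add: split_beta)
  also have "\<dots> = (\<Prod>i\<in>UNIV. (Re (b$i) - Re (a$i)) * (Im (b$i) - Im (a$i)))"
    by (simp add: prod.cartesian_product[symmetric] inner_axis complex_i_not_one[symmetric])
  finally show ?thesis
    using assms by (subst emeasure_lborel_cbox_eq) (auto simp: Basis_complex_vec inner_axis)
qed

lemma prod_distinguished:
  "(\<Prod>i\<in>(UNIV :: 'n::finite set). if i = k then p else q) = p * q ^ (CARD('n) - 1)"
  for p q :: "'a::comm_monoid_mult"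
  by (subst prod.remove[of UNIV k]) (auto simp: card_Diff_singleton)

lemma norm_vec_power2: "(norm z)^2 = (\<Sum>i\<in>UNIV. (cmod (z $ i))^2)" for z :: "complex^'n"
  by (simp add: norm_vec_def L2_set_def sum_nonneg)

text \<open>
  If \<open>|1 - \<eta>\<^sub>k| < t\<close> on the unit sphere, then \<open>|Im \<eta>\<^sub>k| < t\<close>, and \<open>1 - |\<eta>\<^sub>k|\<^sup>2 \<le> 2t\<close> leaves room only for
  \<open>|\<eta>\<^sub>i|\<^sup>2 \<le> 2t\<close> in the other coordinates. Scaling by a radius at most \<open>1\<close> keeps these bounds, so the
  cone lies in a box.
\<close>

lemma emeasure_nonisotropic_cone_axis_le:
  assumes t: "0 < t"
  shows "emeasure lborel (nonisotropic_cone (axis k 1 :: complex^'n) t) \<le> ennreal ((8 * t) ^ CARD('n))"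
proof -
  define a :: "complex^'n" where
    "a = (\<chi> i. if i = k then Complex 1 t else Complex (sqrt (2*t)) (sqrt (2*t)))"
  have "nonisotropic_cone (axis k 1 :: complex^'n) t \<subseteq> cbox (-a) a"
  proof
    fix z :: "complex^'n"
    assume z: "z \<in> nonisotropic_cone (axis k 1) t"
    define w where "w = sgn z"
    have z01: "0 < norm z" "norm z < 1" using z by (auto simp: nonisotropic_cone_def)
    have w1: "norm w = 1" using z01 by (simp add: w_def norm_sgn)
    have "cmod (1 - cnj (w $ k)) < t"
      using z by (simp add: nonisotropic_cone_def cdot_axis_left w_def)
    hence wk: "cmod (1 - w $ k) < t" by (metis complex_cnj_diff complex_cnj_one complex_mod_cnj)
    have shrink: "\<bar>norm z * y\<bar> \<le> b" if "\<bar>y\<bar> \<le> b" for y b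
      using that z01 mult_left_le_one_le[of "\<bar>y\<bar>" "norm z"] by (simp add: abs_mult)
    have comp: "Re (z $ i) = norm z * Re (w $ i)" "Im (z $ i) = norm z * Im (w $ i)" for i
      using z01 by (simp_all add: w_def sgn_div_norm)
    have wi: "cmod (w $ i) \<le> sqrt (2 * t)" if "i \<noteq> k" for i
    proof -
      have "(cmod (w $ i))^2 + (cmod (w $ k))^2 = (\<Sum>j\<in>{i,k}. (cmod (w $ j))^2)"
        using that by simp
      also have "\<dots> \<le> (\<Sum>j\<in>UNIV. (cmod (w $ j))^2)" by (rule sum_mono2) auto
      also have "\<dots> = 1" using norm_vec_power2[of w] w1 by simp
      finally have "(cmod (w $ i))^2 \<le> (1 - cmod (w $ k)) * (1 + cmod (w $ k))"
        by (simp add: algebra_simps power2_eq_square)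
      also have "\<dots> \<le> t * 2"
      proof (rule mult_mono)
        have "1 - cmod (w $ k) \<le> cmod (1 - w $ k)" by (metis norm_one norm_triangle_ineq2)
        thus "1 - cmod (w $ k) \<le> t" using wk by simp
        show "1 + cmod (w $ k) \<le> 2" using Finite_Cartesian_Product.norm_nth_le[of w k] w1 by simp
      qed (use t in auto)
      finally show ?thesis by (simp add: real_le_rsqrt mult.commute)
    qed
    show "z \<in> cbox (-a) a"
      unfolding mem_cbox_complex_vec
    proof
      fix i
      have "\<bar>Re (z $ i)\<bar> \<le> Re (a $ i) \<and> \<bar>Im (z $ i)\<bar> \<le> Im (a $ i)"
      proof (cases "i = k")
        case True
        have "\<bar>Re (w $ k)\<bar> \<le> 1"
          using Finite_Cartesian_Product.norm_nth_le[of w k] w1 abs_Re_le_cmod[of "w $ k"] by simp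
        moreover have "\<bar>Im (w $ k)\<bar> \<le> t"
          using abs_Im_le_cmod[of "1 - w $ k"] wk by simp
        ultimately show ?thesis
          using True unfolding comp by (simp add: a_def shrink del: abs_mult)
      next
        case False
        have "\<bar>Re (w $ i)\<bar> \<le> sqrt (2*t)" "\<bar>Im (w $ i)\<bar> \<le> sqrt (2*t)"
          using wi[OF False] abs_Re_le_cmod[of "w $ i"] abs_Im_le_cmod[of "w $ i"] by linarith+
        thus ?thesis
          using False unfolding comp by (simp add: a_def shrink del: abs_mult)
      qed
      thus "Re ((-a)$i) \<le> Re (z$i) \<and> Re (z$i) \<le> Re (a$i) \<and>
            Im ((-a)$i) \<le> Im (z$i) \<and> Im (z$i) \<le> Im (a$i)" by auto
    qed
  qed
  hence "emeasure lborel (nonisotropic_cone (axis k 1 :: complex^'n) t) \<le> emeasure lborel (cbox (-a) a)"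
    by (rule emeasure_mono) simp
  also have "\<dots> = ennreal (\<Prod>i\<in>(UNIV::'n set). if i = k then 4 * t else 8 * t)"
    using t by (subst emeasure_cbox_complex_vec) (auto simp: a_def intro!: arg_cong[where f=ennreal] prod.cong)
  also have "\<dots> \<le> ennreal (\<Prod>i\<in>(UNIV::'n set). 8 * t)"
    using t by (intro ennreal_leI prod_mono) auto
  finally show ?thesis by simp
qed

text \<open>
  The box has half-width \<open>s\<close> in the direction \<open>Im z\<^sub>k\<close>, half-width \<open>\<surd>s\<close> in the real and imaginary parts
  of the other coordinates, and \<open>Re z\<^sub>k\<close> runs through \<open>[1/4, 1/2]\<close>. There \<open>|z| - Re z\<^sub>k\<close> is quadratic in the
  other real coordinates, hence \<open>O(n s)\<close>, and so is \<open>|1 - z\<^sub>k/|z||\<close>. The choice \<open>s = t/(32 n)\<close> makes it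
  less than \<open>t\<close>, and \<open>t \<le> 4\<close> keeps the box inside the unit ball.
\<close>

lemma emeasure_nonisotropic_cone_axis_ge:
  assumes t: "0 < t" "t \<le> 4"
  shows "ennreal ((t / (8 * CARD('n))) ^ CARD('n) / 8)
           \<le> emeasure lborel (nonisotropic_cone (axis k 1 :: complex^'n) t)"
proof -
  define N where "N = real CARD('n)"
  define s where "s = t / (32 * N)"
  have N: "N \<ge> 1" by (simp add: N_def Suc_leI)
  have Ns: "N * s = t / 32" using N by (simp add: s_def)
  have s0: "s > 0" using t N by (simp add: s_def)
  have sNs: "s \<le> N * s" using s0 N by simp
  have s: "0 < s" "s \<le> 1/8" using s0 sNs Ns t by auto
  define l u :: "complex^'n" where
    "l = (\<chi> i. if i = k then Complex (1/4) (-s) else Complex (-sqrt s) (-sqrt s))" and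
    "u = (\<chi> i. if i = k then Complex (1/2) s else Complex (sqrt s) (sqrt s))"
  have "cbox l u \<subseteq> nonisotropic_cone (axis k 1) t"
  proof
    fix z assume "z \<in> cbox l u"
    hence z: "Re (l$i) \<le> Re (z$i)" "Re (z$i) \<le> Re (u$i)" 
         "Im (l$i) \<le> Im (z$i)" "Im (z$i) \<le> Im (u$i)" for i
      by (auto simp: mem_cbox_complex_vec)
    define x y where "x = Re (z $ k)" and "y = Im (z $ k)"
    have xy: "1/4 \<le> x" "x \<le> 1/2" "\<bar>y\<bar> \<le> s"
      using z[of k] by (auto simp: x_def y_def l_def u_def)
    define P where "P = (\<Sum>i\<in>UNIV-{k}. (cmod (z $ i))^2)"
    have P0: "P \<ge> 0" by (simp add: P_def sum_nonneg)
    have "P \<le> (\<Sum>i\<in>UNIV-{k}. 2 * s)"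
      unfolding P_def
    proof (rule sum_mono)
      fix i assume "i \<in> UNIV - {k}"
      hence "\<bar>Re (z $ i)\<bar> \<le> sqrt s" "\<bar>Im (z $ i)\<bar> \<le> sqrt s"
        using z[of i] by (auto simp: l_def u_def)
      hence "(Re (z $ i))^2 \<le> s" "(Im (z $ i))^2 \<le> s"
        using s by (metis real_sqrt_le_iff real_sqrt_abs)+
      thus "(cmod (z $ i))^2 \<le> 2 * s" by (simp add: cmod_power2)
    qed
    also have "\<dots> \<le> (\<Sum>i\<in>(UNIV::'n set). 2 * s)" using s by (intro sum_mono2) auto
    also have "\<dots> = 2 * (N * s)" by (simp add: N_def)
    finally have P: "P \<le> 2 * (N * s)" .
    have nz: "(norm z)^2 = x^2 + y^2 + P"
      unfolding norm_vec_power2 P_def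
      by (subst sum.remove[of UNIV k]) (auto simp: cmod_power2 x_def y_def)
    have y2: "y^2 \<le> s^2" using xy(3) s by (metis abs_le_square_iff abs_of_pos)
    have s2: "s^2 \<le> s / 8" using s by (simp add: power2_eq_square mult_left_mono)
    have x2: "x^2 \<le> 1/4" using xy power_mono[of x "1/2" 2] by (simp add: power2_eq_square)
    have "(norm z)^2 < 1" using nz x2 y2 s2 P Ns t s by linarith
    hence n1: "norm z < 1" by (simp add: power2_less_1_iff abs_square_less_1)
    have "x^2 \<le> (norm z)^2" using nz P0 by simp
    hence xn: "x \<le> norm z" by (rule power2_le_imp_le) simp
    hence n0: "norm z \<ge> 1/4" using xy by simp
    have "(norm z - x) * (1/2) \<le> (norm z - x) * (norm z + x)"
      using xn n0 xy by (intro mult_left_mono) auto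
    also have "\<dots> = y^2 + P" using nz by (simp add: algebra_simps power2_eq_square)
    finally have nx: "norm z - x \<le> 2 * y^2 + 2 * P" by simp
    have "cmod (norm z - z $ k) \<le> \<bar>norm z - x\<bar> + \<bar>y\<bar>"
      using cmod_le[of "norm z - z $ k"] by (simp add: x_def y_def)
    also have "\<dots> \<le> 6 * (N * s)" using nx xn xy y2 s2 P sNs by simp
    also have "\<dots> < t * (1/4)" using Ns t by simp
    also have "\<dots> \<le> t * norm z" using t n0 by (intro mult_left_mono) auto
    finally have 1: "cmod (norm z - z $ k) < t * norm z" .
    have "1 - sgn z $ k = (norm z - z $ k) / norm z"
    proof -
      have "complex_of_real (norm z) \<noteq> 0" using n0 by auto
      moreover have "sgn z $ k = z $ k / norm z"
        by (simp add: sgn_div_norm scaleR_conv_of_real[where 'a=complex] divide_inverse mult.commute)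
      ultimately show ?thesis by (simp add: diff_divide_distrib)
    qed
    hence "cmod (1 - sgn z $ k) = cmod (norm z - z $ k) / norm z"
      by (simp add: norm_divide)
    also have "\<dots> < t" using 1 n0 t by (simp add: divide_less_eq)
    finally have "cmod (1 - cnj (sgn z $ k)) < t"
      by (metis complex_cnj_diff complex_cnj_one complex_mod_cnj)
    thus "z \<in> nonisotropic_cone (axis k 1) t"
      using n0 n1 by (auto simp: nonisotropic_cone_def cdot_axis_left)
  qed
  hence "emeasure lborel (cbox l u) \<le> emeasure lborel (nonisotropic_cone (axis k 1 :: complex^'n) t)"
    by (rule emeasure_mono) (simp add: open_nonisotropic_cone)
  moreover have "emeasure lborel (cbox l u) = 
    ennreal (\<Prod>i\<in>(UNIV::'n set). if i = k then s / 2 else 4 * s)"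
    using s by (subst emeasure_cbox_complex_vec)
      (auto simp: l_def u_def intro!: arg_cong[where f=ennreal] prod.cong)
  moreover have "(\<Prod>i\<in>(UNIV::'n set). if i = k then s / 2 else 4 * s) = (4 * s) ^ CARD('n) / 8"
    unfolding prod_distinguished by (cases "CARD('n)") auto
  moreover have "4 * s = t / (8 * CARD('n))" by (simp add: s_def N_def)
  ultimately show ?thesis by simp
qed

lemma emeasure_nonisotropic_cone_rotate:
  fixes \<xi> :: "complex^'n"
  assumes "norm \<xi> = 1"
  shows "emeasure lborel (nonisotropic_cone \<xi> t) = emeasure lborel (nonisotropic_cone (axis k 1 :: complex^'n) t)"
proof -
  obtain T where T: "orthogonal_transformation T" "T \<xi> = axis k 1"
    "\<And>x y. cdot (T x) (T y) = cdot x y"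
    using complex_reflection[OF assms, of k] by metis
  have nT: "norm (T z) = norm z" for z by (rule orthogonal_transformation_norm[OF T(1)])
  have sT: "sgn (T z) = T (sgn z)" for z
    unfolding sgn_div_norm nT orthogonal_transformation_scaleR[OF T(1)] ..
  have "cdot (axis k 1) (sgn (T z)) = cdot \<xi> (sgn z)" for z
    unfolding sT T(2)[symmetric] T(3) ..
  moreover have "T z = 0 \<longleftrightarrow> z = 0" for z by (metis nT norm_eq_zero)
  ultimately have mem: "T z \<in> nonisotropic_cone (axis k 1) t \<longleftrightarrow> z \<in> nonisotropic_cone \<xi> t" for z
    by (simp add: nonisotropic_cone_def nT)
  have "T ` nonisotropic_cone \<xi> t = nonisotropic_cone (axis k 1) t"
    using mem orthogonal_transformation_surj[OF T(1)] by (force simp: image_iff) 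
  thus ?thesis
    using emeasure_orthogonal_image[OF T(1) open_nonisotropic_cone, of \<xi> t] by simp
qed

lemma sets_sphere_sigma_borel:
  "A \<in> sets borel \<Longrightarrow> A \<subseteq> sphere 0 1 \<Longrightarrow> A \<in> sets sphere_sigma"
  unfolding sphere_sigma_def
  by (rule sets_completionI_sets) (auto simp: sets_restrict_space_iff)

lemma emeasure_sphere_sigma_borel:
  fixes A :: "(complex^'n) set"
  assumes "A \<in> sets borel" "A \<subseteq> sphere 0 1"
  shows "emeasure sphere_sigma A = 
    emeasure lborel (ball 0 1 \<inter> sgn -` A) / emeasure lborel (ball 0 1 :: (complex^'n) set)"
proof -
  let ?D = "distr (uniform_measure lborel (ball 0 1)) borel sgn :: (complex^'n) measure"
  have sgnm: "sgn \<in> measurable (uniform_measure lborel (ball 0 1)) (borel :: (complex^'n) measure)"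
    unfolding sgn_div_norm by measurable
  have sgnb: "sgn -` A \<in> sets borel"
    using measurable_sets[OF sgnm assms(1)] by simp
  have "A \<in> sets (restrict_space ?D (sphere 0 1))"
    using assms by (auto simp: sets_restrict_space_iff)
  hence "emeasure sphere_sigma A = emeasure (restrict_space ?D (sphere 0 1)) A"
    by (simp add: sphere_sigma_def)
  also have "\<dots> = emeasure ?D A" using assms by (intro emeasure_restrict_space) auto
  also have "\<dots> = emeasure (uniform_measure lborel (ball 0 1)) (sgn -` A)"
    using assms by (subst emeasure_distr[OF sgnm]) auto
  also have "\<dots> = emeasure lborel (ball 0 1 \<inter> sgn -` A) / emeasure lborel (ball 0 1 :: (complex^'n) set)"
    using sgnb by (intro emeasure_uniform_measure) auto
  finally show ?thesis .
qed

lemma space_sphere_sigma: "space sphere_sigma = sphere 0 1"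
  by (simp add: sphere_sigma_def space_restrict_space)

lemma borel_measurable_sphere_sigma:
  assumes "f \<in> borel_measurable borel"
  shows "f \<in> borel_measurable sphere_sigma"
  unfolding sphere_sigma_def
  by (intro measurable_completion measurable_restrict_space1) (use assms in simp)

lemma borel_measurable_cdot_right [measurable]: "(\<lambda>\<eta>. cdot \<xi> \<eta>) \<in> borel_measurable borel"
  by (intro borel_measurable_continuous_onI continuous_on_cdot_right) auto

lemma nonisotropic_ball_borel: "nonisotropic_ball \<xi> \<delta> \<in> sets borel"
proof -
  have "nonisotropic_ball \<xi> \<delta> = sphere 0 1 \<inter> {\<eta> \<in> space borel. sqrt (cmod (1 - cdot \<xi> \<eta>)) < \<delta>}"
    by (auto simp: nonisotropic_ball_def)
  also have "\<dots> \<in> sets borel" by measurable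
  finally show ?thesis .
qed

lemma nonisotropic_ball_sets [measurable]: "nonisotropic_ball \<xi> \<delta> \<in> sets sphere_sigma"
  by (rule sets_sphere_sigma_borel[OF nonisotropic_ball_borel]) (auto simp: nonisotropic_ball_def)

lemma mem_nonisotropic_ball:
  assumes "0 < \<delta>"
  shows "\<eta> \<in> nonisotropic_ball \<xi> \<delta> \<longleftrightarrow> norm \<eta> = 1 \<and> cmod (1 - cdot \<xi> \<eta>) < \<delta>^2"
  using assms real_sqrt_less_iff[of "cmod (1 - cdot \<xi> \<eta>)" "\<delta>^2"]
  by (auto simp: nonisotropic_ball_def)

lemma emeasure_nonisotropic_ball:
  fixes \<xi> :: "complex^'n"
  assumes "0 < \<delta>"
  shows "emeasure sphere_sigma (nonisotropic_ball \<xi> \<delta>) =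
    emeasure lborel (nonisotropic_cone \<xi> (\<delta>^2)) / emeasure lborel (ball 0 1 :: (complex^'n) set)"
proof -
  have "ball 0 1 \<inter> sgn -` nonisotropic_ball \<xi> \<delta> = nonisotropic_cone \<xi> (\<delta>^2)"
    by (auto simp: mem_nonisotropic_ball[OF assms] nonisotropic_cone_def norm_sgn)
  thus ?thesis
    by (subst emeasure_sphere_sigma_borel[OF nonisotropic_ball_borel])
       (auto simp: nonisotropic_ball_def)
qed

lemma measure_nonisotropic_ball_bounds:
  obtains c C :: real where "c > 0" "C > 0"
    "\<And>(\<xi> :: complex^'n) \<delta>. \<lbrakk>norm \<xi> = 1; 0 < \<delta>; \<delta> \<le> 2\<rbrakk> \<Longrightarrow>
       c * \<delta> ^ (2 * CARD('n)) \<le> measure sphere_sigma (nonisotropic_ball \<xi> \<delta>)"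
    "\<And>(\<xi> :: complex^'n) \<delta>. \<lbrakk>norm \<xi> = 1; 0 < \<delta>\<rbrakk> \<Longrightarrow>
       measure sphere_sigma (nonisotropic_ball \<xi> \<delta>) \<le> C * \<delta> ^ (2 * CARD('n))"
proof -
  define b where "b = measure lborel (ball 0 1 :: (complex^'n) set)"
  have b: "b > 0" unfolding b_def by (rule content_ball_pos) simp
  have eb: "emeasure lborel (ball 0 1 :: (complex^'n) set) = ennreal b"
    unfolding b_def using emeasure_lborel_ball_finite[of "0::complex^'n" 1]
    by (intro emeasure_eq_ennreal_measure) auto
  interpret prob_space "sphere_sigma :: (complex^'n) measure" by (rule prob_space_sphere_sigma)
  define N where "N = CARD('n)"
  have formula: "ennreal (measure sphere_sigma (nonisotropic_ball \<xi> \<delta>)) =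
     emeasure lborel (nonisotropic_cone (axis undefined 1 :: complex^'n) (\<delta>^2)) / ennreal b"
    if "norm \<xi> = 1" "0 < \<delta>" for \<xi> :: "complex^'n" and \<delta>
    using that emeasure_nonisotropic_ball[of \<delta> \<xi>]
      emeasure_nonisotropic_cone_rotate[of \<xi> "\<delta>^2" undefined]
    by (simp add: eb emeasure_eq_measure)
  show thesis
  proof (rule that[of "(1 / (8 * N)) ^ N / 8 / b" "8 ^ N / b"])
    show "(1 / (8 * N)) ^ N / 8 / b > 0" "8 ^ N / b > 0" using b by (auto simp: N_def)
  next
    fix \<xi> :: "complex^'n" and \<delta> :: real
    assume *: "norm \<xi> = 1" "0 < \<delta>" "\<delta> \<le> 2"
    have "\<delta>^2 \<le> 4" using * power_mono[of \<delta> 2 2] by simp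
    hence "ennreal ((\<delta>^2 / (8 * N)) ^ N / 8) / ennreal b \<le> ennreal (measure sphere_sigma (nonisotropic_ball \<xi> \<delta>))"
      unfolding formula[OF *(1,2)] N_def
      by (intro divide_right_mono_ennreal emeasure_nonisotropic_cone_axis_ge) (use * in auto)
    hence "(\<delta>^2 / (8 * N)) ^ N / 8 / b \<le> measure sphere_sigma (nonisotropic_ball \<xi> \<delta>)"
      using b by (simp add: divide_ennreal)
    thus "(1 / (8 * N)) ^ N / 8 / b * \<delta> ^ (2 * CARD('n)) \<le> measure sphere_sigma (nonisotropic_ball \<xi> \<delta>)"
      by (simp add: power_divide N_def power_mult)
  next
    fix \<xi> :: "complex^'n" and \<delta> :: real
    assume *: "norm \<xi> = 1" "0 < \<delta>"
    have "ennreal (measure sphere_sigma (nonisotropic_ball \<xi> \<delta>)) \<le> ennreal ((8 * \<delta>^2) ^ N) / ennreal b"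
      unfolding formula[OF *(1,2)] N_def
      by (intro divide_right_mono_ennreal emeasure_nonisotropic_cone_axis_le) (use * in auto)
    hence "measure sphere_sigma (nonisotropic_ball \<xi> \<delta>) \<le> (8 * \<delta>^2) ^ N / b"
      using b by (simp add: divide_ennreal)
    thus "measure sphere_sigma (nonisotropic_ball \<xi> \<delta>) \<le> 8 ^ N / b * \<delta> ^ (2 * CARD('n))"
      by (simp add: N_def power_mult power_mult_distrib)
  qed
qed

section \<open>Ball averages are dominated by Poisson-Szego integrals\<close>

lemma borel_measurable_poisson_kernel [measurable]:
  "(\<lambda>\<zeta>. ennreal (a / cmod (1 - cdot z \<zeta>) ^ m)) \<in> borel_measurable sphere_sigma"
  by (rule borel_measurable_sphere_sigma) measurable

text \<open>
  With \<open>d = min \<delta> 1\<close> and \<open>z = (1 - d\<^sup>2)\<xi>\<close> one has \<open>1 - |z|\<^sup>2 \<ge> d\<^sup>2\<close>, and \<open>|1 - \<langle>z,\<eta>\<rangle>| \<le> 2d\<^sup>2\<close> on \<open>B(\<xi>,\<delta>)\<close>, so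
  there the kernel is at least \<open>4\<^sup>-\<^sup>n d\<^sup>-\<^sup>2\<^sup>n\<close>, hence at least a constant times \<open>1/\<sigma>(B)\<close>. The truncation at \<open>1\<close>
  makes \<open>z = 0\<close>, with kernel \<open>1\<close>, serve all larger balls.
\<close>

lemma sphere_avg_le_poisson_szego:
  obtains K :: real where "K > 0"
    "\<And>(\<xi> :: complex^'n) \<delta>. \<lbrakk>norm \<xi> = 1; 0 < \<delta>\<rbrakk> \<Longrightarrow> \<exists>z\<in>ball 0 1. \<forall>h\<in>borel_measurable sphere_sigma.
       sphere_avg (nonisotropic_ball \<xi> \<delta>) h \<le> ennreal K * poisson_szego h z"
proof -
  interpret prob_space "sphere_sigma :: (complex^'n) measure" by (rule prob_space_sphere_sigma)
  obtain c where c: "c > 0" 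
    "\<And>(\<xi> :: complex^'n) \<delta>. \<lbrakk>norm \<xi> = 1; 0 < \<delta>; \<delta> \<le> 2\<rbrakk> \<Longrightarrow>
       c * \<delta> ^ (2 * CARD('n)) \<le> measure sphere_sigma (nonisotropic_ball \<xi> \<delta>)"
    using measure_nonisotropic_ball_bounds by metis
  define N where "N = CARD('n)"
  define K where "K = 4 ^ N / c"
  have K: "K > 0" using c by (simp add: K_def)
  have "\<exists>z\<in>ball 0 1. \<forall>h\<in>borel_measurable sphere_sigma.
       sphere_avg (nonisotropic_ball \<xi> \<delta>) h \<le> ennreal K * poisson_szego h z"
    if \<xi>: "norm \<xi> = 1" and \<delta>: "0 < \<delta>" for \<xi> :: "complex^'n" and \<delta> :: real
  proof -
    define d where "d = min \<delta> 1"
    define z where "z = (1 - d^2) *\<^sub>R \<xi>"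
    define B where "B = nonisotropic_ball \<xi> \<delta>"
    define P where "P \<eta> = (1 - (norm z)^2) ^ N / cmod (1 - cdot z \<eta>) ^ (2 * N)" for \<eta>
    have d: "0 < d" "d \<le> 1" "d \<le> \<delta>" using \<delta> by (auto simp: d_def)
    have d2: "0 < d^2" "d^2 \<le> 1" using d by (auto simp: power_le_one)
    have nz: "norm z = 1 - d^2" using d2 \<xi> by (simp add: z_def)
    have "c * d ^ (2 * N) \<le> measure sphere_sigma (nonisotropic_ball \<xi> d)"
      unfolding N_def using c(2)[of \<xi> d] \<xi> d by simp
    also have "\<dots> \<le> measure sphere_sigma B"
    proof (rule finite_measure_mono)
      show "nonisotropic_ball \<xi> d \<subseteq> B" using d by (auto simp: B_def nonisotropic_ball_def)
    qed (simp add: B_def nonisotropic_ball_sets)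
    finally have mB: "c * d ^ (2 * N) \<le> measure sphere_sigma B" .
    have mB0: "0 < measure sphere_sigma B" using mB c d by (smt (verit) mult_pos_pos zero_less_power)
    have kernel: "1 \<le> K * measure sphere_sigma B * P \<eta>" if "\<eta> \<in> B" for \<eta>
    proof -
      let ?a = "cdot \<xi> \<eta>"
      have \<eta>: "norm \<eta> = 1" "cmod (1 - ?a) < \<delta>^2"
        using that \<delta> by (auto simp: B_def mem_nonisotropic_ball)
      have a1: "cmod ?a \<le> 1" using norm_cdot_le[of \<xi> \<eta>] \<xi> \<eta> by simp
      have eq: "cdot z \<eta> = (1 - d^2) *\<^sub>R ?a" by (simp add: z_def cdot_scaleR_left)
      have "cmod (cdot z \<eta>) < 1"
      proof -
        have "cmod (cdot z \<eta>) \<le> (1 - d^2) * 1"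
          unfolding eq norm_scaleR using a1 d2 by (intro mult_mono) auto
        also have "\<dots> < 1" using d2(1) by simp
        finally show ?thesis .
      qed
      hence pos: "0 < cmod (1 - cdot z \<eta>)" by auto
      have up: "cmod (1 - cdot z \<eta>) \<le> 2 * d^2"
      proof (cases "\<delta> < 1")
        case True
        have "1 - cdot z \<eta> = (1 - ?a) + d^2 *\<^sub>R ?a" by (simp add: eq algebra_simps)
        hence "cmod (1 - cdot z \<eta>) \<le> cmod (1 - ?a) + cmod (d^2 *\<^sub>R ?a)"
          by (metis norm_triangle_ineq)
        also have "cmod (d^2 *\<^sub>R ?a) \<le> d^2 * 1"
          unfolding norm_scaleR using a1 d2 by (intro mult_mono) auto
        finally show ?thesis using \<eta> True by (simp add: d_def)
      next
        case False
        thus ?thesis by (simp add: eq d_def)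
      qed
      have "1 / (4 ^ N * d ^ (2 * N)) = (d^2) ^ N / (2 * d^2) ^ (2 * N)"
        using d by (simp add: power_mult power_mult_distrib power2_eq_square field_simps)
          (simp flip: power_mult_distrib)
      also have "\<dots> \<le> P \<eta>"
        unfolding P_def
      proof (rule frac_le)
        have "d^2 \<le> 1 - (norm z)^2"
          using mult_left_mono[OF d2(2), of "d^2"] d2 by (simp add: nz power2_eq_square algebra_simps)
        thus "(d^2) ^ N \<le> (1 - (norm z)^2) ^ N" using d2 by (intro power_mono) auto
        show "cmod (1 - cdot z \<eta>) ^ (2 * N) \<le> (2 * d^2) ^ (2 * N)"
          using up by (intro power_mono) auto
      qed (use d2 pos up nz in \<open>auto intro!: power_mono simp: power_le_one abs_square_le_1\<close>)
      finally have "1 / (4 ^ N * d ^ (2 * N)) \<le> P \<eta>" .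
      hence "c * d ^ (2 * N) * (1 / (4 ^ N * d ^ (2 * N))) \<le> measure sphere_sigma B * P \<eta>"
        using mB mB0 d by (intro mult_mono) auto
      hence "c / 4 ^ N \<le> measure sphere_sigma B * P \<eta>" using d by simp
      thus ?thesis using c by (simp add: K_def field_simps)
    qed
    have "sphere_avg B h \<le> ennreal K * poisson_szego h z" 
      if [measurable]: "h \<in> borel_measurable sphere_sigma" for h
    proof -
      let ?s = "measure sphere_sigma B"
      have "(\<integral>\<^sup>+x\<in>B. ennreal (h x) \<partial>sphere_sigma)
          \<le> (\<integral>\<^sup>+x. ennreal (K * ?s) * (ennreal (P x) * ennreal (h x)) \<partial>sphere_sigma)"
      proof (rule nn_integral_mono)
        fix x
        have "1 * ennreal (h x) \<le> ennreal (K * ?s * P x) * ennreal (h x)" if "x \<in> B"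
          using kernel[OF that] by (intro mult_right_mono) auto
        thus "ennreal (h x) * indicator B x \<le> ennreal (K * ?s) * (ennreal (P x) * ennreal (h x))"
          using K mB0 by (auto simp: indicator_def ennreal_mult' mult.assoc)
      qed
      also have "\<dots> = ennreal (K * ?s) * poisson_szego h z"
        unfolding poisson_szego_def P_def N_def by (rule nn_integral_cmult) measurable
      finally have "sphere_avg B h \<le> ennreal (K * ?s) * poisson_szego h z / ennreal ?s"
        unfolding sphere_avg_def emeasure_eq_measure by (rule divide_right_mono_ennreal)
      also have "\<dots> = ennreal (K * ?s) / ennreal ?s * poisson_szego h z"
        by (metis ennreal_times_divide mult.commute)
      also have "ennreal (K * ?s) / ennreal ?s = ennreal K"
        using mB0 K by (simp add: divide_ennreal)
      finally show ?thesis .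
    qed
    moreover have "z \<in> ball 0 1" using nz d2 by simp
    ultimately show ?thesis unfolding B_def by blast
  qed
  thus thesis using that[OF K] by blast
qed

lemma weight_measurable:
  assumes "weight w"
  shows "w \<in> borel_measurable sphere_sigma" "(\<lambda>x. inverse (w x)) \<in> borel_measurable sphere_sigma"
proof -
  show "w \<in> borel_measurable sphere_sigma" using assms by (auto simp: weight_def)
  thus "(\<lambda>x. inverse (w x)) \<in> borel_measurable sphere_sigma" by measurable
qed

lemma Q2_le_Q2_inv:
  obtains c1 :: real where "c1 > 0"
    "\<And>w :: complex^'n \<Rightarrow> real. weight w \<Longrightarrow> Q2 w \<le> ennreal c1 * Q2_inv w"
proof -
  obtain K :: real where K: "K > 0"
    "\<And>(\<xi> :: complex^'n) \<delta>. \<lbrakk>norm \<xi> = 1; 0 < \<delta>\<rbrakk> \<Longrightarrow> \<exists>z\<in>ball 0 1. \<forall>h\<in>borel_measurable sphere_sigma.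
       sphere_avg (nonisotropic_ball \<xi> \<delta>) h \<le> ennreal K * poisson_szego h z"
    using sphere_avg_le_poisson_szego by metis
  have "Q2 w \<le> ennreal (K * K) * Q2_inv w" if w: "weight w" for w :: "complex^'n \<Rightarrow> real"
    unfolding Q2_def
  proof (rule SUP_least, clarify)
    fix \<xi> :: "complex^'n" and \<delta> :: real
    assume "\<xi> \<in> sphere 0 1" "\<delta> > 0"
    then obtain z where z: "z \<in> ball 0 1" 
      "\<And>h. h \<in> borel_measurable sphere_sigma \<Longrightarrow>
         sphere_avg (nonisotropic_ball \<xi> \<delta>) h \<le> ennreal K * poisson_szego h z"
      using K(2)[of \<xi> \<delta>] by auto
    have "sphere_avg (nonisotropic_ball \<xi> \<delta>) w * sphere_avg (nonisotropic_ball \<xi> \<delta>) (\<lambda>x. inverse (w x))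
      \<le> (ennreal K * poisson_szego w z) * (ennreal K * poisson_szego (\<lambda>x. inverse (w x)) z)"
      using weight_measurable[OF w] by (intro mult_mono z(2)) auto
    also have "\<dots> = ennreal (K * K) * (poisson_szego w z * poisson_szego (\<lambda>x. inverse (w x)) z)"
      using K(1) by (simp add: ennreal_mult mult_ac)
    also have "\<dots> \<le> ennreal (K * K) * Q2_inv w"
      unfolding Q2_inv_def using z(1) by (intro mult_left_mono SUP_upper) auto
    finally show "sphere_avg (nonisotropic_ball \<xi> \<delta>) w * sphere_avg (nonisotropic_ball \<xi> \<delta>) (\<lambda>x. inverse (w x))
      \<le> ennreal (K * K) * Q2_inv w" .
  qed
  moreover have "K * K > 0" using K(1) by simp
  ultimately show thesis using that by blast
qed

section \<open>Double sums over scales\<close>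

text \<open>
  Decay gives \<open>1/(\<epsilon> V\<^sub>k) \<le> (1 - \<epsilon>)/(\<epsilon> V\<^sub>k\<^sub>+\<^sub>1)\<close>, which leaves room for exactly one more term \<open>1/V\<^sub>k\<^sub>+\<^sub>1\<close>.
\<close>

lemma sum_inverse_le_of_geometric_decay:
  fixes V :: "nat \<Rightarrow> real"
  assumes pos: "\<And>i. i \<le> J \<Longrightarrow> V i > 0"
    and decay: "\<And>i. i < J \<Longrightarrow> V (Suc i) \<le> (1 - \<epsilon>) * V i"
    and \<epsilon>: "0 < \<epsilon>" "\<epsilon> \<le> 1" and "k \<le> J"
  shows "(\<Sum>i\<le>k. 1 / V i) \<le> 1 / (\<epsilon> * V k)"
  using \<open>k \<le> J\<close>
proof (induction k)
  case 0
  thus ?case using pos[of 0] \<epsilon> by (simp add: field_simps)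
next
  case (Suc k)
  have p: "V k > 0" "V (Suc k) > 0" using pos Suc.prems by auto
  have "1 / (\<epsilon> * V k) \<le> (1 - \<epsilon>) / (\<epsilon> * V (Suc k))"
    using decay[of k] Suc.prems p \<epsilon> by (simp add: field_simps)
  hence "(\<Sum>i\<le>Suc k. 1 / V i) \<le> (1 - \<epsilon>) / (\<epsilon> * V (Suc k)) + 1 / V (Suc k)"
    using Suc by simp
  also have "\<dots> = 1 / (\<epsilon> * V (Suc k))" using p \<epsilon> by (simp add: field_simps)
  finally show ?case .
qed

text \<open>
  The square of index pairs is covered by the triangles \<open>i \<le> k\<close> and \<open>k \<le> i\<close>.
\<close>

lemma sum_mult_sum_le_triangles:
  fixes a b :: "nat \<Rightarrow> real"
  assumes "\<And>i. a i \<ge> 0" "\<And>i. b i \<ge> 0"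
  shows "(\<Sum>i\<le>J. a i) * (\<Sum>k\<le>J. b k) \<le> (\<Sum>k\<le>J. b k * (\<Sum>i\<le>k. a i)) + (\<Sum>i\<le>J. a i * (\<Sum>k\<le>i. b k))"
proof (induction J)
  case 0
  show ?case using assms by (simp add: mult.commute)
next
  case (Suc J)
  thus ?case using mult_nonneg_nonneg[OF assms(1,2), of "Suc J" "Suc J"]
    by (simp add: algebra_simps)
qed

text \<open>
  The pairs \<open>i \<le> k\<close>: the hypothesis on \<open>W\<^sub>i V\<^sub>i\<close> replaces \<open>W\<^sub>i/\<rho>\<^sub>i\<^sup>2\<close> by \<open>A/V\<^sub>i\<close>, the decay of \<open>V\<close> sums this over
  \<open>i\<close> to \<open>A/(\<epsilon> V\<^sub>k)\<close>, which cancels the factor \<open>V\<^sub>k\<close>, and the remaining sum of \<open>\<rho>\<^sub>k\<^sup>-\<^sup>2\<close> is at most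
  twice its last term.
\<close>

lemma triangle_sum_le:
  fixes W V \<rho> :: "nat \<Rightarrow> real"
  assumes pos: "\<And>i. V i > 0" "\<And>i. \<rho> i > 0"
    and A2: "\<And>i. W i * V i \<le> A * (\<rho> i)^2"
    and decay: "\<And>i. i < J \<Longrightarrow> V (Suc i) \<le> (1 - \<epsilon>) * V i"
    and \<epsilon>: "0 < \<epsilon>" "\<epsilon> \<le> 1"
    and half: "\<And>i. \<rho> (Suc i) \<le> \<rho> i / 2" and A: "0 \<le> A"
  shows "(\<Sum>k\<le>J. V k / (\<rho> k)^2 * (\<Sum>i\<le>k. W i / (\<rho> i)^2)) \<le> 2 * A / (\<epsilon> * (\<rho> J)^2)"
proof -
  have inner: "V k / (\<rho> k)^2 * (\<Sum>i\<le>k. W i / (\<rho> i)^2) \<le> A / \<epsilon> * (1 / (\<rho> k)^2)" if "k \<le> J" for k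
  proof -
    have "W i / (\<rho> i)^2 \<le> A * (1 / V i)" for i
      using A2[of i] pos[of i] by (simp add: field_simps)
    hence "(\<Sum>i\<le>k. W i / (\<rho> i)^2) \<le> A * (\<Sum>i\<le>k. 1 / V i)"
      unfolding sum_distrib_left by (intro sum_mono)
    also have "\<dots> \<le> A * (1 / (\<epsilon> * V k))"
      by (intro mult_left_mono sum_inverse_le_of_geometric_decay[of J]) (use assms that in auto)
    finally have "V k / (\<rho> k)^2 * (\<Sum>i\<le>k. W i / (\<rho> i)^2) \<le> V k / (\<rho> k)^2 * (A * (1 / (\<epsilon> * V k)))"
      using pos[of k] by (intro mult_left_mono) auto
    also have "\<dots> = A / \<epsilon> * (1 / (\<rho> k)^2)" using pos[of k] by simp
    finally show ?thesis .
  qed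
  have sq: "(\<rho> (Suc i))^2 \<le> (1 - 1/2) * (\<rho> i)^2" for i
  proof -
    have "(\<rho> (Suc i))^2 \<le> (\<rho> i / 2)^2"
      using half[of i] pos(2)[of "Suc i"] by (intro power_mono) auto
    also have "\<dots> \<le> (1 - 1/2) * (\<rho> i)^2" by (simp add: power_divide)
    finally show ?thesis .
  qed
  have "(\<Sum>k\<le>J. V k / (\<rho> k)^2 * (\<Sum>i\<le>k. W i / (\<rho> i)^2)) \<le> (\<Sum>k\<le>J. A / \<epsilon> * (1 / (\<rho> k)^2))"
    by (intro sum_mono inner) auto
  also have "\<dots> = A / \<epsilon> * (\<Sum>k\<le>J. 1 / (\<rho> k)^2)" by (simp only: sum_distrib_left)
  also have "\<dots> \<le> A / \<epsilon> * (1 / (1/2 * (\<rho> J)^2))"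
    using A \<epsilon> pos(2) sq
    by (intro mult_left_mono sum_inverse_le_of_geometric_decay[of J]) (auto simp: less_imp_neq[symmetric])
  also have "\<dots> = 2 * A / (\<epsilon> * (\<rho> J)^2)" by simp
  finally show ?thesis .
qed

lemma product_of_weighted_sums_le:
  fixes W V \<rho> :: "nat \<Rightarrow> real"
  assumes pos: "\<And>i. W i > 0" "\<And>i. V i > 0" "\<And>i. \<rho> i > 0"
    and A2: "\<And>i. W i * V i \<le> A * (\<rho> i)^2"
    and decay: "\<And>i. i < J \<Longrightarrow> W (Suc i) \<le> (1 - \<epsilon>) * W i"
       "\<And>i. i < J \<Longrightarrow> V (Suc i) \<le> (1 - \<epsilon>) * V i"
    and \<epsilon>: "0 < \<epsilon>" "\<epsilon> \<le> 1"
    and half: "\<And>i. \<rho> (Suc i) \<le> \<rho> i / 2" and A: "0 \<le> A"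
  shows "(\<Sum>i\<le>J. W i / (\<rho> i)^2) * (\<Sum>k\<le>J. V k / (\<rho> k)^2) \<le> 4 * A / (\<epsilon> * (\<rho> J)^2)"
proof -
  have "(\<Sum>i\<le>J. W i / (\<rho> i)^2) * (\<Sum>k\<le>J. V k / (\<rho> k)^2)
    \<le> (\<Sum>k\<le>J. V k / (\<rho> k)^2 * (\<Sum>i\<le>k. W i / (\<rho> i)^2)) +
      (\<Sum>i\<le>J. W i / (\<rho> i)^2 * (\<Sum>k\<le>i. V k / (\<rho> k)^2))"
    using pos by (intro sum_mult_sum_le_triangles) (simp_all add: less_imp_le)
  also have "\<dots> \<le> 2 * A / (\<epsilon> * (\<rho> J)^2) + 2 * A / (\<epsilon> * (\<rho> J)^2)"
    by (intro add_mono triangle_sum_le) (use assms in \<open>auto simp: mult.commute\<close>)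
  finally show ?thesis by simp
qed

section \<open>Poisson-Szego integrals of weights\<close>

text \<open>
  \<open>J\<close> is the last index with \<open>R\<^sub>J\<^sup>2 \<ge> 1 - r\<close>, where \<open>R\<^sub>i = 2/M\<^sup>i\<close>. Fix \<open>\<eta>\<close> and let \<open>B(\<xi>,R\<^sub>i)\<close> be the smallest
  of the balls up to \<open>J\<close> that contains it. Since \<open>|1 - r\<langle>\<xi>,\<eta>\<rangle>|\<close> is at least \<open>1 - r\<close> and at least
  \<open>|1 - \<langle>\<xi>,\<eta>\<rangle>|/2\<close>, it is at least \<open>R\<^sub>i\<^sup>2/(2M\<^sup>2)\<close>: by the first bound if \<open>i = J\<close>, by the second if \<open>i < J\<close>,
  as \<open>\<eta>\<close> is then outside the next ball. As \<open>1 - r\<^sup>2 \<le> 2 R\<^sub>J\<^sup>2\<close>, the kernel at \<open>\<eta>\<close> is at most the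
  \<open>i\<close>-th term of the sum.
\<close>

lemma poisson_kernel_le_dyadic_sum:
  fixes \<xi> :: "complex^'n"
  assumes \<xi>: "norm \<xi> = 1" and r: "0 \<le> r" "r < 1" and M: "2 \<le> M"
  defines "N \<equiv> CARD('n)"
  obtains J where "\<And>\<eta>. norm \<eta> = 1 \<Longrightarrow>
    (1 - r^2) ^ N / cmod (1 - cdot (r *\<^sub>R \<xi>) \<eta>) ^ (2 * N) \<le>
    (\<Sum>i\<le>J. 2 ^ N * (2 * M^2) ^ (2 * N) * (2 / M ^ J) ^ (2 * N) / ((2 / M ^ i) ^ (2 * N))^2
            * indicator (nonisotropic_ball \<xi> (2 / M ^ i)) \<eta>)"
proof -
  define R where "R i = 2 / M ^ i" for i :: nat
  define d where "d = 1 - r"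
  have d: "0 < d" "d \<le> 1" using r by (auto simp: d_def)
  have R0: "R i > 0" for i using M by (simp add: R_def)
  have RS: "(R (Suc i))^2 = (R i)^2 / M^2" for i by (simp add: R_def power_divide power_mult_distrib)
  have "\<exists>i. (R (Suc i))^2 < d"
  proof -
    obtain i where i: "(1 / M) ^ i < d / 4"
      using real_arch_pow_inv[of "d/4" "1/M"] d M by auto
    have "(R (Suc i))^2 = 4 * ((1 / M) ^ Suc i)^2" by (simp add: R_def power_divide)
    also have "\<dots> \<le> 4 * (1 / M) ^ i"
    proof -
      have "((1 / M) ^ Suc i)^2 = (1/M) ^ (i + (i + 2))" 
        by (simp only: power_mult[symmetric]) (simp add: mult_2_right)
      also have "\<dots> \<le> (1/M) ^ i" using M by (intro power_decreasing) auto
      finally show ?thesis by simp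
    qed
    also have "\<dots> < d" using i by simp
    finally show ?thesis by blast
  qed
  then obtain J where J: "(R (Suc J))^2 < d" and least: "\<And>i. i < J \<Longrightarrow> \<not> (R (Suc i))^2 < d"
    using exists_least_iff[of "\<lambda>i. (R (Suc i))^2 < d"] by blast
  have RJ: "d \<le> (R J)^2"
  proof (cases J)
    case 0
    thus ?thesis using d by (simp add: R_def)
  next
    case (Suc i)
    thus ?thesis using least[of i] by simp
  qed
  define c where "c i = 2 ^ N * (2 * M^2) ^ (2 * N) * (R J) ^ (2 * N) / ((R i) ^ (2 * N))^2" for i
  have c0: "c i \<ge> 0" for i using M R0 by (simp add: c_def less_imp_le)
  show thesis
  proof (rule that[of J], fold R_def, fold c_def)
    fix \<eta> :: "complex^'n" assume \<eta>: "norm \<eta> = 1"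
    let ?a = "cdot \<xi> \<eta>"
    define q where "q = cmod (1 - cdot (r *\<^sub>R \<xi>) \<eta>)"
    have a1: "cmod ?a \<le> 1" using norm_cdot_le[of \<xi> \<eta>] \<xi> \<eta> by simp
    have ra: "cmod (r *\<^sub>R ?a) \<le> r * 1"
      unfolding norm_scaleR using a1 r by (intro mult_mono) auto
    have qd: "d \<le> q"
      using norm_triangle_ineq2[of 1 "r *\<^sub>R ?a"] ra by (simp add: q_def d_def cdot_scaleR_left)
    have "1 - ?a = (1 - r *\<^sub>R ?a) - d *\<^sub>R ?a" by (simp add: d_def algebra_simps)
    hence "cmod (1 - ?a) \<le> cmod (1 - r *\<^sub>R ?a) + cmod (d *\<^sub>R ?a)"
      by (metis norm_triangle_ineq4)
    also have "cmod (d *\<^sub>R ?a) \<le> d * 1"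
      unfolding norm_scaleR using a1 d by (intro mult_mono) auto
    finally have qa: "cmod (1 - ?a) \<le> 2 * q" using qd by (simp add: q_def cdot_scaleR_left)
    \<comment> \<open>The radius of \<open>B(\<xi>,R\<^sub>0)\<close> is \<open>2\<close>, so this ball is the whole sphere and \<open>I\<close> is not empty.\<close>
    define I where "I = {i. i \<le> J \<and> \<eta> \<in> nonisotropic_ball \<xi> (R i)}"
    have "cmod (1 - ?a) \<le> cmod 1 + cmod ?a" by (rule norm_triangle_ineq4)
    hence "\<eta> \<in> nonisotropic_ball \<xi> (R 0)"
      using a1 \<eta> by (subst mem_nonisotropic_ball) (auto simp: R_def)
    hence I: "finite I" "0 \<in> I" by (auto simp: I_def)
    define i where "i = Max I"
    have i: "i \<in> I" "\<And>j. j \<in> I \<Longrightarrow> j \<le> i" using I by (auto simp: i_def intro: Max_in)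
    have iJ: "i \<le> J" using i by (simp add: I_def)
    have q: "(R i)^2 / (2 * M^2) \<le> q"
    proof (cases "i = J")
      case True
      have "(R J)^2 / (2 * M^2) \<le> (R J)^2 / M^2" using M by (intro divide_left_mono) auto
      thus ?thesis using True J qd RS[of J] by simp
    next
      case False
      hence "Suc i \<notin> I" "Suc i \<le> J" using i(2)[of "Suc i"] iJ by auto
      hence "\<not> cmod (1 - ?a) < (R (Suc i))^2"
        using \<eta> mem_nonisotropic_ball[OF R0[of "Suc i"], of \<eta> \<xi>] by (auto simp: I_def)
      thus ?thesis using qa RS[of i] by simp
    qed
    have "(1 - r^2) ^ N / q ^ (2 * N) \<le> (2 * (R J)^2) ^ N / ((R i)^2 / (2 * M^2)) ^ (2 * N)"
    proof (rule frac_le)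
      have "1 - r^2 = d * (1 + r)" by (simp add: d_def algebra_simps power2_eq_square)
      also have "\<dots> \<le> (R J)^2 * 2" using RJ r d by (intro mult_mono) auto
      finally show "(1 - r^2) ^ N \<le> (2 * (R J)^2) ^ N"
        using r by (intro power_mono) (auto simp: power_le_one)
      show "((R i)^2 / (2 * M^2)) ^ (2 * N) \<le> q ^ (2 * N)"
        using q M by (intro power_mono) auto
      show "0 < ((R i)^2 / (2 * M^2)) ^ (2 * N)" using R0[of i] M by (intro zero_less_power divide_pos_pos) auto
    qed (use R0 in simp)
    also have "\<dots> = c i"
      using R0[of i] M by (simp add: c_def power_mult power_mult_distrib power_divide mult.commute flip: power_mult)
    also have "\<dots> = c i * indicator (nonisotropic_ball \<xi> (R i)) \<eta>" using i by (simp add: I_def)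
    also have "\<dots> \<le> (\<Sum>i\<le>J. c i * indicator (nonisotropic_ball \<xi> (R i)) \<eta>)"
      using iJ c0 by (intro member_le_sum[of i "{..J}" "\<lambda>i. c i * indicator (nonisotropic_ball \<xi> (R i)) \<eta>"]) auto
    finally show "(1 - r^2) ^ N / cmod (1 - cdot (r *\<^sub>R \<xi>) \<eta>) ^ (2 * N)
      \<le> (\<Sum>i\<le>J. c i * indicator (nonisotropic_ball \<xi> (R i)) \<eta>)" by (simp add: q_def)
  qed
qed

lemma weight_Cauchy_Schwarz:
  fixes w :: "complex^'n \<Rightarrow> real"
  assumes w: "weight w" and E: "E \<in> sets sphere_sigma"
  shows "(emeasure sphere_sigma E)^2 \<le>
    (\<integral>\<^sup>+x\<in>E. ennreal (w x) \<partial>sphere_sigma) * (\<integral>\<^sup>+x\<in>E. ennreal (inverse (w x)) \<partial>sphere_sigma)"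
proof -
  let ?f = "\<lambda>x. ennreal (sqrt (w x)) * indicator E x"
  let ?g = "\<lambda>x. ennreal (sqrt (inverse (w x))) * indicator E x"
  note [measurable] = weight_measurable[OF w] E
  have pos: "AE x in sphere_sigma. w x > 0" using w by (simp add: weight_def)
  have "(\<integral>\<^sup>+x. ?f x * ?g x \<partial>sphere_sigma) = (\<integral>\<^sup>+x. indicator E x \<partial>sphere_sigma)"
  proof (rule nn_integral_cong_AE, use pos in eventually_elim)
    case (elim x)
    have "sqrt (w x) * sqrt (inverse (w x)) = 1"
      using elim by (simp flip: real_sqrt_mult)
    thus ?case using elim by (auto simp: indicator_def simp flip: ennreal_mult)
  qed
  hence "(emeasure sphere_sigma E)^2 = (\<integral>\<^sup>+x. ?f x * ?g x \<partial>sphere_sigma)^2" using E by simp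
  also have "\<dots> \<le> (\<integral>\<^sup>+x. ?f x ^ 2 \<partial>sphere_sigma) * (\<integral>\<^sup>+x. ?g x ^ 2 \<partial>sphere_sigma)"
    by (rule Cauchy_Schwarz_nn_integral) measurable
  also have "(\<integral>\<^sup>+x. ?f x ^ 2 \<partial>sphere_sigma) = (\<integral>\<^sup>+x\<in>E. ennreal (w x) \<partial>sphere_sigma)"
    by (rule nn_integral_cong_AE, use pos in eventually_elim)
       (auto simp: indicator_def ennreal_power)
  also have "(\<integral>\<^sup>+x. ?g x ^ 2 \<partial>sphere_sigma) = (\<integral>\<^sup>+x\<in>E. ennreal (inverse (w x)) \<partial>sphere_sigma)"
    by (rule nn_integral_cong_AE, use pos in eventually_elim)
       (auto simp: indicator_def ennreal_power)
  finally show ?thesis .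
qed

text \<open>
  Cauchy-Schwarz on \<open>B - B'\<close>, which carries at least half of \<open>s\<close>, gives
  \<open>s(B)\<^sup>2/4 \<le> m\<^sub>1(B) m\<^sub>2(B - B')\<close>; the \<open>A\<^sub>2\<close> bound on \<open>B\<close> then reads \<open>m\<^sub>2(B) \<le> 4Q m\<^sub>2(B - B')\<close>.
\<close>

lemma reverse_doubling:
  assumes fin: "finite_measure s" "finite_measure m1" "finite_measure m2"
    and sets: "sets m1 = sets s" "sets m2 = sets s"
    and CS: "\<And>E. E \<in> sets s \<Longrightarrow> (measure s E)^2 \<le> measure m1 E * measure m2 E"
    and B: "B \<in> sets s" "B' \<in> sets s" "B' \<subseteq> B"
    and half: "measure s B' \<le> measure s B / 2" "0 < measure s B"
    and A2: "measure m1 B * measure m2 B \<le> Q * (measure s B)^2" and Q: "0 < Q"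
  shows "measure m2 B' \<le> (1 - 1 / (4 * Q)) * measure m2 B"
proof -
  have s: "measure s (B - B') = measure s B - measure s B'"
    using B by (intro finite_measure.finite_measure_Diff fin) auto
  have m2: "measure m2 (B - B') = measure m2 B - measure m2 B'"
    using B sets by (intro finite_measure.finite_measure_Diff fin) auto
  have "(measure s B / 2)^2 \<le> (measure s (B - B'))^2"
    using half by (intro power_mono) (auto simp: s)
  also have "\<dots> \<le> measure m1 (B - B') * measure m2 (B - B')" using B by (intro CS) auto
  also have "\<dots> \<le> measure m1 B * measure m2 (B - B')"
    using B sets by (intro mult_right_mono finite_measure.finite_measure_mono fin) auto
  finally have 1: "(measure s B)^2 \<le> 4 * (measure m1 B * measure m2 (B - B'))"
    by (simp add: power_divide)
  have m1: "0 < measure m1 B"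
  proof (rule ccontr)
    assume "\<not> 0 < measure m1 B"
    hence "measure m1 B = 0" using measure_nonneg[of m1 B] by linarith
    thus False using 1 half by simp
  qed
  have "measure m1 B * measure m2 B \<le> Q * (4 * (measure m1 B * measure m2 (B - B')))"
    using A2 mult_left_mono[OF 1, of Q] Q by linarith
  hence "measure m1 B * measure m2 B \<le> measure m1 B * (4 * Q * measure m2 (B - B'))"
    by (simp add: mult_ac)
  hence "measure m2 B \<le> 4 * Q * (measure m2 B - measure m2 B')"
    using m1 m2 by simp
  thus ?thesis using Q by (simp add: field_simps)
qed

lemma poisson_szego_le_sum:
  fixes z :: "complex^'n"
  assumes kernel: "\<And>\<eta>. norm \<eta> = 1 \<Longrightarrow>
      (1 - (norm z)^2) ^ CARD('n) / cmod (1 - cdot z \<eta>) ^ (2 * CARD('n)) \<le> (\<Sum>i\<le>J. c i * indicator (B i) \<eta>)"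
    and c: "\<And>i. 0 \<le> c i"
    and B: "\<And>i. B i \<in> sets sphere_sigma" and [measurable]: "h \<in> borel_measurable sphere_sigma"
  shows "poisson_szego h z \<le> (\<Sum>i\<le>J. ennreal (c i) * (\<integral>\<^sup>+x\<in>B i. ennreal (h x) \<partial>sphere_sigma))"
proof -
  note [measurable] = B
  have "poisson_szego h z \<le> (\<integral>\<^sup>+x. (\<Sum>i\<le>J. ennreal (c i) * (ennreal (h x) * indicator (B i) x)) \<partial>sphere_sigma)"
    unfolding poisson_szego_def
  proof (rule nn_integral_mono)
    fix x :: "complex^'n" assume "x \<in> space sphere_sigma"
    hence "norm x = 1" by (simp add: space_sphere_sigma)
    hence "ennreal ((1 - (norm z)^2) ^ CARD('n) / cmod (1 - cdot z x) ^ (2 * CARD('n)))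
        \<le> ennreal (\<Sum>i\<le>J. c i * indicator (B i) x)"
      using kernel by (intro ennreal_leI) auto
    also have "\<dots> = (\<Sum>i\<le>J. ennreal (c i * indicator (B i) x))"
      using c by (intro sum_ennreal[symmetric]) auto
    also have "\<dots> = (\<Sum>i\<le>J. ennreal (c i) * indicator (B i) x)"
      by (intro sum.cong) (auto simp: indicator_def)
    finally show "ennreal ((1 - (norm z)^2) ^ CARD('n) / cmod (1 - cdot z x) ^ (2 * CARD('n))) * ennreal (h x)
        \<le> (\<Sum>i\<le>J. ennreal (c i) * (ennreal (h x) * indicator (B i) x))"
      by (rule order_trans[OF mult_right_mono]) (auto simp: sum_distrib_left mult_ac)
  qed
  also have "\<dots> = (\<Sum>i\<le>J. \<integral>\<^sup>+x. ennreal (c i) * (ennreal (h x) * indicator (B i) x) \<partial>sphere_sigma)"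
    by (rule nn_integral_sum) measurable
  also have "\<dots> = (\<Sum>i\<le>J. ennreal (c i) * (\<integral>\<^sup>+x\<in>B i. ennreal (h x) \<partial>sphere_sigma))"
    by (intro sum.cong nn_integral_cmult) auto
  finally show ?thesis .
qed

lemma Q2_inv_le_square_Q2:
  obtains c2 :: real where "c2 > 0"
    "\<And>w :: complex^'n \<Rightarrow> real. weight w \<Longrightarrow> Q2_inv w \<le> ennreal c2 * (Q2 w)^2"
proof -
  let ?\<sigma> = "sphere_sigma :: (complex^'n) measure"
  interpret sigma: prob_space ?\<sigma> by (rule prob_space_sphere_sigma)
  define N where "N = CARD('n)"
  have N1: "N \<ge> 1" by (simp add: N_def Suc_leI)
  obtain c C where c: "c > 0" "C > 0"
    "\<And>(\<xi> :: complex^'n) \<delta>. \<lbrakk>norm \<xi> = 1; 0 < \<delta>; \<delta> \<le> 2\<rbrakk> \<Longrightarrow>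
       c * \<delta> ^ (2 * N) \<le> measure ?\<sigma> (nonisotropic_ball \<xi> \<delta>)"
    "\<And>(\<xi> :: complex^'n) \<delta>. \<lbrakk>norm \<xi> = 1; 0 < \<delta>\<rbrakk> \<Longrightarrow>
       measure ?\<sigma> (nonisotropic_ball \<xi> \<delta>) \<le> C * \<delta> ^ (2 * N)"
    unfolding N_def using measure_nonisotropic_ball_bounds by metis
  \<comment> \<open>This ratio of consecutive radii is so large that \<open>C \<rho>\<^sub>i\<^sub>+\<^sub>1 \<le> c \<rho>\<^sub>i / 2\<close>: each ball has at most half the
    measure of the one before it.\<close>
  define M where "M = 2 + 2 * C / c"
  have M: "2 \<le> M" using c by (simp add: M_def)
  have M0: "0 < M" using M by simp
  define R where "R i = 2 / M ^ i" for i :: nat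
  define \<rho> where "\<rho> i = R i ^ (2 * N)" for i
  have R: "0 < R i" "R i \<le> 2" for i
    using M by (auto simp: R_def field_simps)
  have \<rho>0: "0 < \<rho> i" for i using R by (simp add: \<rho>_def)
  have \<rho>S: "\<rho> (Suc i) * M \<le> \<rho> i" for i
  proof -
    have "R (Suc i) = R i / M" by (simp add: R_def)
    hence "\<rho> (Suc i) = \<rho> i / M ^ (2 * N)" by (simp add: \<rho>_def power_divide)
    also have "\<dots> \<le> \<rho> i / M ^ 1"
      using N1 M \<rho>0[of i] by (intro divide_left_mono power_increasing) auto
    finally show ?thesis using M0 by (simp add: field_simps)
  qed
  have \<rho>half: "\<rho> (Suc i) \<le> \<rho> i / 2" for i
    using \<rho>S[of i] mult_left_mono[OF M less_imp_le[OF \<rho>0[of "Suc i"]]] by simp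
  define L where "L = 2 ^ N * (2 * M^2) ^ (2 * N)"
  have L: "0 < L" using M by (simp add: L_def)
  define c2 where "c2 = 16 * (L * C)^2"
  have c2: "c2 > 0" using L c by (simp add: c2_def)
  have "Q2_inv w \<le> ennreal c2 * (Q2 w)^2" if w: "weight w" for w :: "complex^'n \<Rightarrow> real"
  proof (cases "Q2 w = \<infinity>")
    case True
    thus ?thesis using c2 by (simp add: ennreal_mult_top power2_eq_square)
  next
    case False
    define Q where "Q = enn2real (Q2 w)"
    have Q: "Q2 w = ennreal Q" "Q \<ge> 0"
      using False by (auto simp: Q_def less_top)
    let ?v = "\<lambda>x. inverse (w x)"
    note [measurable] = weight_measurable[OF w]
    \<comment> \<open>With \<open>w d\<sigma>\<close> and \<open>w\<^sup>-\<^sup>1 d\<sigma>\<close> as finite measures the estimates can be done in real numbers.\<close>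
    define \<mu> where "\<mu> = density ?\<sigma> (\<lambda>x. ennreal (w x))"
    define \<nu> where "\<nu> = density ?\<sigma> (\<lambda>x. ennreal (?v x))"
    have sets: "sets \<mu> = sets ?\<sigma>" "sets \<nu> = sets ?\<sigma>" by (simp_all add: \<mu>_def \<nu>_def)
    have e\<mu>: "(\<integral>\<^sup>+x\<in>E. ennreal (w x) \<partial>?\<sigma>) = emeasure \<mu> E"
      and e\<nu>: "(\<integral>\<^sup>+x\<in>E. ennreal (?v x) \<partial>?\<sigma>) = emeasure \<nu> E" if "E \<in> sets ?\<sigma>" for E
      using that by (simp_all add: \<mu>_def \<nu>_def emeasure_density)
    have CSe: "(emeasure ?\<sigma> E)^2 \<le> emeasure \<mu> E * emeasure \<nu> E" if "E \<in> sets ?\<sigma>" for E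
      using weight_Cauchy_Schwarz[OF w that] by (simp add: e\<mu> e\<nu> that)
    have avg: "sphere_avg B w * sphere_avg B ?v =
        (emeasure \<mu> B / emeasure ?\<sigma> B) * (emeasure \<nu> B / emeasure ?\<sigma> B)" if "B \<in> sets ?\<sigma>" for B
      using that by (simp add: sphere_avg_def e\<mu> e\<nu>)
    have Q2B: "(emeasure \<mu> B / emeasure ?\<sigma> B) * (emeasure \<nu> B / emeasure ?\<sigma> B) \<le> ennreal Q"
      if "B = nonisotropic_ball \<xi> \<delta>" "norm \<xi> = 1" "0 < \<delta>" for B \<xi> \<delta>
    proof -
      have "sphere_avg B w * sphere_avg B ?v \<le> Q2 w"
        unfolding Q2_def that(1) using that(2,3) by (intro SUP_upper2[of "(\<xi>, \<delta>)"]) auto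
      thus ?thesis using avg[of B] that Q by (simp add: nonisotropic_ball_sets)
    qed
    have S: "nonisotropic_ball \<xi> 2 = sphere 0 1" if "norm \<xi> = 1" for \<xi> :: "complex^'n"
    proof -
      have "cmod (1 - cdot \<xi> \<eta>) < 2^2" if "norm \<eta> = 1" for \<eta>
        using norm_cdot_le[of \<xi> \<eta>] norm_triangle_ineq4[of 1 "cdot \<xi> \<eta>"] that \<open>norm \<xi> = 1\<close> by simp
      thus ?thesis by (auto simp: mem_nonisotropic_ball)
    qed
    have fin\<mu>: "emeasure \<mu> (sphere 0 1) < \<infinity>"
    proof -
      have "emeasure \<mu> (sphere 0 1) \<le> (\<integral>\<^sup>+x. ennreal (norm (w x)) \<partial>?\<sigma>)"
        unfolding e\<mu>[symmetric, OF sets.top[of ?\<sigma>, unfolded space_sphere_sigma]]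
        by (intro nn_integral_mono) (auto simp: indicator_def intro!: ennreal_leI)
      also have "\<dots> < \<infinity>" using w by (auto simp: weight_def integrable_iff_bounded)
      finally show ?thesis .
    qed
    \<comment> \<open>The sphere is itself a ball, so a finite \<open>A\<^sub>2\<close> characteristic forces \<open>w\<^sup>-\<^sup>1\<close> to be integrable.\<close>
    have fin\<nu>: "emeasure \<nu> (sphere 0 1) < \<infinity>"
    proof (rule ccontr)
      assume *: "\<not> ?thesis"
      let ?e = "axis undefined 1 :: complex^'n"
      have e: "norm ?e = 1" by simp
      have s1: "emeasure ?\<sigma> (sphere 0 1) = 1"
        using sigma.emeasure_space_1 by (simp add: space_sphere_sigma)
      have "emeasure \<mu> (sphere 0 1) \<noteq> 0"
      proof
        assume "emeasure \<mu> (sphere 0 1) = 0"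
        thus False using CSe[OF sets.top[of ?\<sigma>, unfolded space_sphere_sigma]] by (simp add: s1)
      qed
      hence "emeasure \<mu> (sphere 0 1) * emeasure \<nu> (sphere 0 1) = \<infinity>"
        using * by (auto simp: less_top[symmetric] ennreal_mult_eq_top_iff)
      thus False using Q2B[OF S[symmetric, OF e] e] 
        by (simp add: s1 divide_ennreal_def top_unique)
    qed
    have space: "space \<mu> = sphere 0 1" "space \<nu> = sphere 0 1"
      by (simp_all add: \<mu>_def \<nu>_def space_sphere_sigma)
    interpret mu: finite_measure \<mu> by (rule finite_measureI) (use fin\<mu> space in auto)
    interpret nu: finite_measure \<nu> by (rule finite_measureI) (use fin\<nu> space in auto)
    have CS: "(measure ?\<sigma> E)^2 \<le> measure \<mu> E * measure \<nu> E" if "E \<in> sets ?\<sigma>" for E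
      using CSe[OF that] unfolding sigma.emeasure_eq_measure mu.emeasure_eq_measure nu.emeasure_eq_measure
      by (simp add: ennreal_power flip: ennreal_mult)
    have A2B: "measure \<mu> B * measure \<nu> B \<le> Q * (measure ?\<sigma> B)^2" 
      if "B = nonisotropic_ball \<xi> \<delta>" "norm \<xi> = 1" "0 < \<delta>" "0 < measure ?\<sigma> B" for B \<xi> \<delta>
    proof -
      have "(measure \<mu> B / measure ?\<sigma> B) * (measure \<nu> B / measure ?\<sigma> B) \<le> Q"
        using Q2B[OF that(1-3)] that(4) Q(2)
        unfolding sigma.emeasure_eq_measure mu.emeasure_eq_measure nu.emeasure_eq_measure
        by (simp add: divide_ennreal flip: ennreal_mult)
      thus ?thesis using that(4) by (simp add: field_simps power2_eq_square)
    qed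
    have "poisson_szego w z * poisson_szego ?v z \<le> ennreal c2 * (Q2 w)^2" if z: "z \<in> ball 0 1" for z
    proof -
      obtain \<xi> where \<xi>: "norm \<xi> = 1" "z = norm z *\<^sub>R \<xi>"
      proof (cases "z = 0")
        case True
        thus ?thesis using that[of "axis undefined 1"] by simp
      next
        case False
        thus ?thesis using that[of "sgn z"] by (simp add: norm_sgn sgn_div_norm)
      qed
      define B where "B i = nonisotropic_ball \<xi> (R i)" for i
      have B: "B i \<in> sets ?\<sigma>" for i by (simp add: B_def nonisotropic_ball_sets)
      have sB: "c * \<rho> i \<le> measure ?\<sigma> (B i)" "measure ?\<sigma> (B i) \<le> C * \<rho> i" for i
        using c(3,4)[OF \<xi>(1) R(1)[of i]] R(2)[of i] by (auto simp: B_def \<rho>_def)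
      have s0: "0 < measure ?\<sigma> (B i)" for i using sB(1)[of i] c \<rho>0[of i] by (smt (verit) mult_pos_pos)
      have sub: "B (Suc i) \<subseteq> B i" for i
      proof -
        have "R (Suc i) \<le> R i" using M R(1)[of i] by (simp add: R_def field_simps)
        thus ?thesis by (auto simp: B_def nonisotropic_ball_def)
      qed
      have shalf: "measure ?\<sigma> (B (Suc i)) \<le> measure ?\<sigma> (B i) / 2" for i
      proof -
        have "C * 2 \<le> c * M" using c by (simp add: M_def field_simps)
        hence "C * \<rho> (Suc i) * 2 \<le> c * (\<rho> (Suc i) * M)"
          using \<rho>0[of "Suc i"] by (simp add: mult.assoc mult.left_commute)
        also have "\<dots> \<le> c * \<rho> i" using \<rho>S[of i] c by simp
        finally show ?thesis using sB(2)[of "Suc i"] sB(1)[of i] by linarith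
      qed
      have A2i: "measure \<mu> (B i) * measure \<nu> (B i) \<le> Q * (measure ?\<sigma> (B i))^2" for i
        using A2B[OF B_def \<xi>(1) R(1) s0] .
      have pos: "0 < measure \<mu> (B i)" "0 < measure \<nu> (B i)" for i
      proof -
        have "0 < measure \<mu> (B i) * measure \<nu> (B i)"
          using CS[OF B[of i]] s0[of i] by (smt (verit) zero_less_power)
        thus "0 < measure \<mu> (B i)" "0 < measure \<nu> (B i)"
          using measure_nonneg[of \<mu> "B i"] measure_nonneg[of \<nu> "B i"] by (auto simp: zero_less_mult_iff)
      qed
      \<comment> \<open>Cauchy-Schwarz bounds \<open>Q\<close> below, so that the decay rate \<open>1/(4Q)\<close> is at most \<open>1\<close>.\<close>
      have Q1: "1 \<le> Q"
      proof -
        have "1 * (measure ?\<sigma> (B 0))^2 \<le> Q * (measure ?\<sigma> (B 0))^2"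
          using CS[OF B[of 0]] A2i[of 0] by simp
        thus ?thesis using s0[of 0] by (simp only: mult_le_cancel_right) auto
      qed
      have decay\<nu>: "measure \<nu> (B (Suc i)) \<le> (1 - 1 / (4 * Q)) * measure \<nu> (B i)" for i
        by (rule reverse_doubling[of ?\<sigma> \<mu> \<nu>])
           (use sets CS B sub shalf s0 A2i Q1 sigma.finite_measure_axioms mu.finite_measure_axioms
              nu.finite_measure_axioms in auto)
      have decay\<mu>: "measure \<mu> (B (Suc i)) \<le> (1 - 1 / (4 * Q)) * measure \<mu> (B i)" for i
        by (rule reverse_doubling[of ?\<sigma> \<nu> \<mu>])
           (use sets CS B sub shalf s0 A2i Q1 sigma.finite_measure_axioms mu.finite_measure_axioms
              nu.finite_measure_axioms in \<open>auto simp: mult.commute[of "measure \<nu> _"]\<close>)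
      have "norm z < 1" using z by simp
      hence "\<exists>J. \<forall>\<eta>. norm \<eta> = 1 \<longrightarrow>
          (1 - (norm z)^2) ^ N / cmod (1 - cdot (norm z *\<^sub>R \<xi>) \<eta>) ^ (2 * N) \<le>
          (\<Sum>i\<le>J. L * \<rho> J / (\<rho> i)^2 * indicator (B i) \<eta>)"
        unfolding L_def \<rho>_def R_def B_def N_def
        by (rule poisson_kernel_le_dyadic_sum[OF \<xi>(1) norm_ge_zero _ M]) blast
      then obtain J where J: "\<And>\<eta>. norm \<eta> = 1 \<Longrightarrow>
          (1 - (norm z)^2) ^ N / cmod (1 - cdot z \<eta>) ^ (2 * N) \<le>
          (\<Sum>i\<le>J. L * \<rho> J / (\<rho> i)^2 * indicator (B i) \<eta>)"
        unfolding \<xi>(2)[symmetric] by blast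
      have bound: "poisson_szego h z \<le> ennreal (L * \<rho> J * (\<Sum>i\<le>J. measure m (B i) / (\<rho> i)^2))"
        if h: "h \<in> borel_measurable ?\<sigma>" "finite_measure m"
          "\<And>i. (\<integral>\<^sup>+x\<in>B i. ennreal (h x) \<partial>?\<sigma>) = emeasure m (B i)" for h m
      proof -
        have "poisson_szego h z \<le> (\<Sum>i\<le>J. ennreal (L * \<rho> J / (\<rho> i)^2) * emeasure m (B i))"
          unfolding h(3)[symmetric]
          by (rule poisson_szego_le_sum) (use J B h(1) L \<rho>0 in \<open>auto simp: N_def less_imp_le\<close>)
        also have "\<dots> = (\<Sum>i\<le>J. ennreal (L * \<rho> J / (\<rho> i)^2 * measure m (B i)))"
          unfolding finite_measure.emeasure_eq_measure[OF h(2)]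
          using L \<rho>0 by (intro sum.cong refl ennreal_mult[symmetric]) (simp_all add: less_imp_le)
        also have "\<dots> = ennreal (\<Sum>i\<le>J. L * \<rho> J / (\<rho> i)^2 * measure m (B i))"
          using L \<rho>0 by (intro sum_ennreal) (simp add: less_imp_le)
        also have "(\<Sum>i\<le>J. L * \<rho> J / (\<rho> i)^2 * measure m (B i)) = L * \<rho> J * (\<Sum>i\<le>J. measure m (B i) / (\<rho> i)^2)"
          by (simp add: sum_distrib_left)
        finally show ?thesis .
      qed
      let ?SW = "\<Sum>i\<le>J. measure \<mu> (B i) / (\<rho> i)^2" and ?SV = "\<Sum>i\<le>J. measure \<nu> (B i) / (\<rho> i)^2"
      have "?SW * ?SV \<le> 4 * (Q * C^2) / (1 / (4 * Q) * (\<rho> J)^2)"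
      proof (rule product_of_weighted_sums_le)
        fix i
        have "Q * (measure ?\<sigma> (B i))^2 \<le> Q * (C * \<rho> i)^2"
          using sB[of i] Q by (intro mult_left_mono power_mono) auto
        thus "measure \<mu> (B i) * measure \<nu> (B i) \<le> Q * C^2 * (\<rho> i)^2"
          using A2i[of i] by (simp add: power_mult_distrib mult.assoc)
      qed (use pos \<rho>0 decay\<mu> decay\<nu> \<rho>half Q1 in auto)
      hence "(L * \<rho> J)^2 * (?SW * ?SV) \<le> (L * \<rho> J)^2 * (4 * (Q * C^2) / (1 / (4 * Q) * (\<rho> J)^2))"
        by (rule mult_left_mono) simp
      also have "\<dots> = c2 * Q^2"
        using \<rho>0[of J] Q1 by (simp add: c2_def power2_eq_square)
      finally have real: "(L * \<rho> J * ?SW) * (L * \<rho> J * ?SV) \<le> c2 * Q^2"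
        by (simp add: power2_eq_square mult_ac)
      have "poisson_szego w z * poisson_szego ?v z \<le> ennreal (L * \<rho> J * ?SW) * ennreal (L * \<rho> J * ?SV)"
        by (intro mult_mono bound)
           (use e\<mu> e\<nu> B mu.finite_measure_axioms nu.finite_measure_axioms in auto)
      also have "\<dots> = ennreal ((L * \<rho> J * ?SW) * (L * \<rho> J * ?SV))"
        using L \<rho>0 by (intro ennreal_mult[symmetric] mult_nonneg_nonneg sum_nonneg) (auto simp: less_imp_le)
      also have "\<dots> \<le> ennreal (c2 * Q^2)" by (rule ennreal_leI[OF real])
      also have "\<dots> = ennreal c2 * (Q2 w)^2" using Q c2 by (simp add: ennreal_mult ennreal_power)
      finally show ?thesis .
    qed
    thus ?thesis unfolding Q2_inv_def by (rule SUP_least)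
  qed
  thus thesis using that[OF c2] by blast
qed

section \<open>Comparison of the two characteristics\<close>

theorem theorem1p2:
  shows "(\<exists>c1 c2 :: real. c1 > 0 \<and> c2 > 0 \<and>
            (\<forall>w :: complex^'n \<Rightarrow> real. weight w \<longrightarrow>
               Q2 w \<le> ennreal c1 * Q2_inv w \<and> Q2_inv w \<le> ennreal c2 * (Q2 w)^2))
       \<and> (A2 :: (complex^'n \<Rightarrow> real) set) = A2_inv"
proof -
  obtain c1 where c1: "c1 > 0"
    "\<And>w :: complex^'n \<Rightarrow> real. weight w \<Longrightarrow> Q2 w \<le> ennreal c1 * Q2_inv w"
    using Q2_le_Q2_inv by blast
  obtain c2 where c2: "c2 > 0"
    "\<And>w :: complex^'n \<Rightarrow> real. weight w \<Longrightarrow> Q2_inv w \<le> ennreal c2 * (Q2 w)^2"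
    using Q2_inv_le_square_Q2 by blast
  have "Q2 w < \<infinity> \<longleftrightarrow> Q2_inv w < \<infinity>" if "weight w" for w :: "complex^'n \<Rightarrow> real"
  proof
    assume "Q2 w < \<infinity>"
    hence "ennreal c2 * (Q2 w)^2 < \<infinity>"
      by (simp add: ennreal_mult_less_top power2_eq_square)
    thus "Q2_inv w < \<infinity>" using c2(2)[OF that] by (rule le_less_trans[rotated])
  next
    assume "Q2_inv w < \<infinity>"
    hence "ennreal c1 * Q2_inv w < \<infinity>" by (simp add: ennreal_mult_less_top)
    thus "Q2 w < \<infinity>" using c1(2)[OF that] by (rule le_less_trans[rotated])
  qed
  hence "(A2 :: (complex^'n \<Rightarrow> real) set) = A2_inv" by (auto simp: A2_def A2_inv_def)
  thus ?thesis using c1 c2 by blast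
qed

end
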